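(* Let $A$ be a finitely generated reduced $\mathbb{R}$-algebra, $V=\operatorname{Spec}(A)$, $B=A[x_1,x_2,x_3,\dots]$ the polynomial ring over $A$ in countably many variables, $X=\operatorname{Spec}(B)$, and let $\pi:X\to V$ be the projection induced by the inclusion $A\hookrightarrow B$. Let $Y\subseteq X(\mathbb{R})$ be a basic equivariant semi-algebraic set. Then the image $\pi(Y)$ is a semi-algebraic subset of $V(\mathbb{R})$.
   Context: The group $G=\operatorname{Sym}(\infty)=\bigcup_k\operatorname{Sym}(k)$ acts on $B$ by $A$-algebra automorphisms with $\sigma(x_i)=x_{\sigma(i)}$. $X(\mathbb{R})=\operatorname{Hom}_{\mathbb{R}}(B,\mathbb{R})=V(\mathbb{R})\times\mathbb{R}^{\mathbb{N}}$, and $V(\mathbb{R})=\operatorname{Hom}_{\mathbb{R}}(A,\mathbb{R})$. A basic equivariant semi-algebraic set is a subset of $X(\mathbb{R})$ of the form $$\bigcap_{\sigma\in G}\{p\in X(\mathbb{R}):\ (\sigma f_1)(p)\ge0,\dots,(\sigma f_r)(p)\ge0,\ (\sigma g_1)(p)>0,\dots,(\sigma g_s)(p)>0\}$$ for some $f_1,\dots,f_r,g_1,\dots,g_s\in B$. A semi-algebraic subset of $V(\mathbb{R})$ is a finite Boolean combination of sets of the form $\{v\in V(\mathbb{R}):a(v)\ge0\}$ with $a\in A$. *)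

theory Defs
  imports
    Complex_Main
    HOL.Hull
    "HOL-Library.Poly_Mapping"
    "HOL-Combinatorics.Permutations"
begin

text \<open>
  A commutative unital \<open>\<real>\<close>-algebra is a type of sort
  \<open>{comm_ring, comm_monoid_mult, real_algebra}\<close>; its structure map is \<open>c \<mapsto> c *\<^sub>R 1\<close>.
  The sort \<open>{comm_ring_1, real_algebra_1}\<close> is avoided because it would impose
  \<open>0 \<noteq> 1\<close> and so exclude the zero algebra.
\<close>

definition real_subalgebra :: "'a::{comm_ring, comm_monoid_mult, real_algebra} set \<Rightarrow> bool" where
  "real_subalgebra T \<longleftrightarrow>
     1 \<in> T \<and> (\<forall>a\<in>T. \<forall>b\<in>T. a + b \<in> T) \<and> (\<forall>a\<in>T. \<forall>b\<in>T. a * b \<in> T) \<and> (\<forall>c. \<forall>a\<in>T. c *\<^sub>R a \<in> T)"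

definition fin_gen_real_algebra ::
    "'a::{comm_ring, comm_monoid_mult, real_algebra} itself \<Rightarrow> bool" where
  "fin_gen_real_algebra _ \<longleftrightarrow> (\<exists>S::'a set. finite S \<and> real_subalgebra hull S = UNIV)"

definition reduced_ring :: "'a::{comm_ring, comm_monoid_mult} itself \<Rightarrow> bool" where
  "reduced_ring _ \<longleftrightarrow> (\<forall>(a::'a) n::nat. a ^ n = 0 \<longrightarrow> a = 0)"

text \<open>
  The polynomial ring \<open>B = A[x\<^sub>0, x\<^sub>1, \<dots>]\<close>: finitely supported families of coefficients
  indexed by monomials, which are finitely supported families of exponents. The variables are
  numbered from \<open>0\<close>. The ring operations are those of \<^theory>\<open>HOL-Library.Poly_Mapping\<close>.
\<close>

type_synonym 'a inf_poly = "(nat \<Rightarrow>\<^sub>0 nat) \<Rightarrow>\<^sub>0 'a"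

definition const_poly :: "'a::zero \<Rightarrow> 'a inf_poly" where
  "const_poly a = Poly_Mapping.single 0 a"

definition var_poly :: "nat \<Rightarrow> 'a::{zero, one} inf_poly" where
  "var_poly i = Poly_Mapping.single (Poly_Mapping.single i 1) 1"

definition Sym_infty :: "(nat \<Rightarrow> nat) set" where
  "Sym_infty = (\<Union>k. {\<sigma>. \<sigma> permutes {..<k}})"

text \<open>
  The \<open>A\<close>-algebra automorphism with \<open>x\<^sub>i \<mapsto> x\<^bsub>\<sigma>(i)\<^esub>\<close>. It sends a monomial \<open>m\<close> to
  \<open>m \<circ> \<sigma>\<inverse>\<close>, so the coefficient of \<open>\<sigma> f\<close> at \<open>m\<close> is that of \<open>f\<close> at \<open>m \<circ> \<sigma>\<close>;
  the lemmas below confirm its defining properties. Since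
  \<^const>\<open>Poly_Mapping.map_key\<close> is only meaningful for injective maps,
  this is used for \<open>\<sigma> \<in> Sym_infty\<close> only.
\<close>

definition perm_act :: "(nat \<Rightarrow> nat) \<Rightarrow> 'a::zero inf_poly \<Rightarrow> 'a inf_poly" where
  "perm_act \<sigma> f = Poly_Mapping.map_key (Poly_Mapping.map_key \<sigma>) f"

lemma bij_Sym_infty: "\<sigma> \<in> Sym_infty \<Longrightarrow> bij \<sigma>"
  by (auto simp: Sym_infty_def dest: permutes_bij)

lemma bij_map_key:
  assumes "bij \<sigma>"
  shows "bij (Poly_Mapping.map_key \<sigma> :: (nat \<Rightarrow>\<^sub>0 nat) \<Rightarrow> _)"
proof -
  have inj: "inj \<sigma>" "inj (inv \<sigma>)" and "surj \<sigma>"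
    using assms by (auto simp: bij_is_inj bij_is_surj bij_imp_bij_inv)
  show ?thesis
    by (rule o_bij[of "Poly_Mapping.map_key (inv \<sigma>)"];
        rule ext; rule poly_mapping_eqI)
      (simp_all add: map_key.rep_eq inj surj_f_inv_f[OF \<open>surj \<sigma>\<close>])
qed

lemma lookup_perm_act:
  assumes "\<sigma> \<in> Sym_infty"
  shows "Poly_Mapping.lookup (perm_act \<sigma> f) m =
         Poly_Mapping.lookup f (Poly_Mapping.map_key \<sigma> m)"
  using bij_map_key[OF bij_Sym_infty[OF assms]]
  by (simp add: perm_act_def map_key.rep_eq bij_is_inj)

lemma perm_act_const:
  assumes "\<sigma> \<in> Sym_infty"
  shows "perm_act \<sigma> (const_poly a) = const_poly a"
proof -
  have "Poly_Mapping.map_key \<sigma> (0::nat \<Rightarrow>\<^sub>0 nat) = 0"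
    using bij_Sym_infty[OF assms] by (simp add: bij_is_inj)
  then show ?thesis
    using map_key_single[OF bij_is_inj[OF bij_map_key[OF bij_Sym_infty[OF assms]]], of 0 a]
    by (simp add: perm_act_def const_poly_def)
qed

lemma perm_act_var:
  assumes "\<sigma> \<in> Sym_infty"
  shows "perm_act \<sigma> (var_poly i) = var_poly (\<sigma> i)"
proof -
  have "Poly_Mapping.map_key \<sigma> (Poly_Mapping.single (\<sigma> i) (1::nat)) = Poly_Mapping.single i 1"
    using bij_Sym_infty[OF assms] by (simp add: bij_is_inj)
  then show ?thesis
    using map_key_single[OF bij_is_inj[OF bij_map_key[OF bij_Sym_infty[OF assms]]],
        of "Poly_Mapping.single (\<sigma> i) 1" 1]
    by (simp add: perm_act_def var_poly_def)
qed

lemma perm_act_add: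
  fixes f g :: "'a::comm_monoid_add inf_poly"
  assumes "\<sigma> \<in> Sym_infty"
  shows "perm_act \<sigma> (f + g) = perm_act \<sigma> f + perm_act \<sigma> g"
  by (rule poly_mapping_eqI) (simp add: lookup_perm_act[OF assms] lookup_add)

lemma perm_act_mult:
  fixes f g :: "'a::comm_ring inf_poly"
  assumes "\<sigma> \<in> Sym_infty"
  shows "perm_act \<sigma> (f * g) = perm_act \<sigma> f * perm_act \<sigma> g"
proof (rule poly_mapping_eqI)
  fix k :: "nat \<Rightarrow>\<^sub>0 nat"
  let ?h = "Poly_Mapping.map_key \<sigma> :: (nat \<Rightarrow>\<^sub>0 nat) \<Rightarrow> _"
  have b: "bij ?h" by (rule bij_map_key[OF bij_Sym_infty[OF assms]])
  have add: "?h (l + q) = ?h l + ?h q" for l q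
    using bij_Sym_infty[OF assms] by (simp add: map_key_plus bij_is_inj)
  have eq: "?h k = ?h l + ?h q \<longleftrightarrow> k = l + q" for l q
    using bij_is_inj[OF b] by (simp flip: add add: inj_eq)
  have reindex: "Sum_any F = Sum_any (\<lambda>l. F (?h l))" for F :: "_ \<Rightarrow> 'a"
    by (rule Sum_any.reindex_cong[OF b]) (simp add: o_def)
  have "Poly_Mapping.lookup (perm_act \<sigma> (f * g)) k =
        prod_fun (Poly_Mapping.lookup f) (Poly_Mapping.lookup g) (?h k)"
    by (simp add: lookup_perm_act[OF assms] times_poly_mapping.rep_eq)
  also have "\<dots> = (\<Sum>l. Poly_Mapping.lookup f (?h l) *
                    (\<Sum>q. (Poly_Mapping.lookup g (?h q) when ?h k = ?h l + ?h q)))"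
    unfolding prod_fun_def by (subst reindex, subst reindex) (rule refl)
  also have "\<dots> = Poly_Mapping.lookup (perm_act \<sigma> f * perm_act \<sigma> g) k"
    by (simp add: eq times_poly_mapping.rep_eq prod_fun_def lookup_perm_act[OF assms])
  finally show "Poly_Mapping.lookup (perm_act \<sigma> (f * g)) k =
                Poly_Mapping.lookup (perm_act \<sigma> f * perm_act \<sigma> g) k" .
qed

text \<open>
  \<open>Hom\<^sub>\<real>(R, \<real>)\<close> for a commutative \<open>\<real>\<close>-algebra \<open>R\<close> with structure map \<open>\<iota>\<close>. The last condition
  gives \<open>\<real>\<close>-linearity and, for \<open>c = 1\<close>, that units are preserved.
\<close>

definition real_alg_homs :: "(real \<Rightarrow> 'r::comm_ring) \<Rightarrow> ('r \<Rightarrow> real) set" where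
  "real_alg_homs \<iota> =
     {p. (\<forall>f g. p (f + g) = p f + p g) \<and> (\<forall>f g. p (f * g) = p f * p g) \<and> (\<forall>c. p (\<iota> c) = c)}"

definition V_real :: "('a::{comm_ring, comm_monoid_mult, real_algebra} \<Rightarrow> real) set" where
  "V_real = real_alg_homs (\<lambda>c. c *\<^sub>R 1)"

definition X_real :: "('a::{comm_ring, comm_monoid_mult, real_algebra} inf_poly \<Rightarrow> real) set" where
  "X_real = real_alg_homs (\<lambda>c. const_poly (c *\<^sub>R 1))"

text \<open>The map \<open>X(\<real>) \<rightarrow> V(\<real>)\<close> given by restriction along \<open>A \<hookrightarrow> B\<close>.\<close>

definition proj_V :: "('a::zero inf_poly \<Rightarrow> real) \<Rightarrow> ('a \<Rightarrow> real)" where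
  "proj_V p = (\<lambda>a. p (const_poly a))"

inductive semialgebraic_V ::
    "('a::{comm_ring, comm_monoid_mult, real_algebra} \<Rightarrow> real) set \<Rightarrow> bool" where
  basic: "semialgebraic_V {v \<in> V_real. v a \<ge> 0}"
| compl: "semialgebraic_V S \<Longrightarrow> semialgebraic_V (V_real - S)"
| union: "semialgebraic_V S \<Longrightarrow> semialgebraic_V T \<Longrightarrow> semialgebraic_V (S \<union> T)"
| inter: "semialgebraic_V S \<Longrightarrow> semialgebraic_V T \<Longrightarrow> semialgebraic_V (S \<inter> T)"

definition basic_equivariant_semialgebraic ::
    "('a::{comm_ring, comm_monoid_mult, real_algebra} inf_poly \<Rightarrow> real) set \<Rightarrow> bool" where
  "basic_equivariant_semialgebraic Y \<longleftrightarrow>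
     (\<exists>fs gs :: 'a inf_poly list.
        Y = (\<Inter>\<sigma>\<in>Sym_infty.
               {p \<in> X_real. (\<forall>f\<in>set fs. p (perm_act \<sigma> f) \<ge> 0) \<and>
                            (\<forall>g\<in>set gs. p (perm_act \<sigma> g) > 0)}))"

end

theory Submission
  imports
    Defs
    "HOL-Computational_Algebra.Polynomial"
    "HOL-Library.Multiset_Order"
    "HOL-Library.Sublist"
begin

text \<open>
  A point of \<open>X(\<real>)\<close> over \<open>v\<close> is a real sequence \<open>x\<close>, and it lies in \<open>Y\<close> iff every tuple of
  entries of \<open>x\<close> with distinct indices satisfies a fixed condition \<open>\<Phi>\<close> in \<open>m\<close> variables. This
  property passes to subsequences, so \<open>x\<close> may be taken to be constant, or to tend to some \<open>c\<close> strictly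
  from one side, or to tend to \<open>\<plusminus>\<infinity>\<close>. In each case \<open>x\<close> converges along a filter that decides
  every semialgebraic set, whence ``for almost all \<open>t\<^sub>1\<close>, for almost all \<open>t\<^sub>2\<close>, \<dots>, the symmetrized
  condition \<open>\<Phi>\<close> holds'' with respect to that filter. Conversely, from this iterated statement an
  infinite sequence is built term by term, because a finite conjunction of ``almost all''
  statements is again one. So the image is described by finitely many quantifiers over \<open>\<real>\<close>.

  Quantifiers are eliminated in the style of Cohen and Hoermander: for finitely many polynomials
  in \<open>t\<close> with parameters, finitely many signs of polynomials in the parameters determine the sign
  diagram up to an increasing bijection of \<open>\<real>\<close>. Such a bijection transports both \<open>\<exists>t\<close> and
  ``almost all \<open>t\<close>''.
\<close>

section \<open>Sign diagrams of real polynomials\<close>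

text \<open>The points of \<open>W\<close> are added in increasing order: \<open>h\<close> is
  followed by a map that is the identity up to \<open>h a\<close>, where \<open>a\<close> is the
  largest old point, and linear above it.\<close>

lemma extend_strict_mono:
  fixes d :: "real \<Rightarrow> real"
  assumes "finite W" "strict_mono_on W d"
  shows "\<exists>h. strict_mono h \<and> surj h \<and> (\<forall>w\<in>W. h w = d w)"
  using assms
proof (induction W rule: finite_linorder_max_induct)
  case empty
  have "strict_mono (\<lambda>t::real. t)" by (simp add: strict_mono_def)
  then show ?case by (intro exI[of _ "\<lambda>t. t"]) auto
next
  case (insert b A)
  have "strict_mono_on A d"
    using insert.prems by (auto simp: strict_mono_on_def)
  then obtain h where h: "strict_mono h" "surj h" "\<forall>w\<in>A. h w = d w"
    using insert.IH by blast
  show ?case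
  proof (cases "A = {}")
    case True
    have "surj (\<lambda>t. t - b + d b)"
      by (rule surjI[of _ "\<lambda>s. s + b - d b"]) simp
    then show ?thesis using True
      by (intro exI[of _ "\<lambda>t. t - b + d b"]) (auto simp: strict_mono_def)
  next
    case False
    define a where "a = Max A"
    have aA: "a \<in> A" and a_max: "\<And>w. w \<in> A \<Longrightarrow> w \<le> a"
      using False insert.hyps(1) by (auto simp: a_def)
    have ab: "a < b" using insert.hyps(2) aA by blast
    have "d a < d b" using insert.prems aA ab by (auto simp: strict_mono_on_def)
    then have hadb: "h a < d b" using h(3) aA by simp
    have hab: "h a < h b" using h(1) ab by (simp add: strict_mono_def)
    \<comment> \<open>The slope that makes the linear part send \<open>h b\<close> to
      \<open>d b\<close>.\<close>
    define e where "e = (d b - h a) / (h b - h a)"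
    have e: "e > 0" using hadb hab by (simp add: e_def)
    define k where "k = (\<lambda>y. if y \<le> h a then y else h a + (y - h a) * e)"
    have "strict_mono k"
    proof (rule strict_monoI)
      fix x y :: real assume "x < y"
      then show "k x < k y"
        using e by (auto simp: k_def) (smt (verit) mult_pos_pos)
    qed
    moreover have "surj k"
    proof (rule surjI[of _ "\<lambda>y. if y \<le> h a then y else h a + (y - h a) / e"])
      fix y show "k (if y \<le> h a then y else h a + (y - h a) / e) = y"
        using e by (auto simp: k_def divide_le_0_iff)
    qed
    ultimately have "strict_mono (k \<circ> h)" "surj (k \<circ> h)"
      using h(1,2) comp_surj by (simp_all add: strict_mono_def, blast)
    moreover have "(k \<circ> h) w = d w" if "w \<in> insert b A" for w
    proof (cases "w = b")
      case True
      then show ?thesis using hab by (simp add: k_def e_def)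
    next
      case False
      then have "w \<in> A" using that by simp
      moreover from this have "h w \<le> h a"
        using a_max h(1) by (simp add: strict_mono_less_eq)
      ultimately show ?thesis using h(3) by (simp add: k_def)
    qed
    ultimately show ?thesis by blast
  qed
qed

text \<open>
  For \<open>t \<in> Z\<close> the cell is \<open>{t}\<close>, otherwise it is the component of \<open>-Z\<close> that contains \<open>t\<close>.
\<close>

definition cell :: "real set \<Rightarrow> real \<Rightarrow> real set" where
  "cell Z t = {s. \<forall>z\<in>Z. (z < t \<longleftrightarrow> z < s) \<and> (t < z \<longleftrightarrow> s < z)}"

lemma cell_self: "t \<in> cell Z t"
  by (simp add: cell_def)

lemma cell_mem: "t \<in> Z \<Longrightarrow> s \<in> cell Z t \<Longrightarrow> s = t"
  by (fastforce simp: cell_def)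

lemma cell_eq: "s \<in> cell Z t \<Longrightarrow> cell Z s = cell Z t"
  by (auto simp: cell_def)

lemma cell_notin: "t \<notin> Z \<Longrightarrow> s \<in> cell Z t \<Longrightarrow> s \<notin> Z"
  by (fastforce simp: cell_def)

lemma cell_between: "s \<in> cell Z t \<Longrightarrow> s' \<in> cell Z t \<Longrightarrow> s \<le> u \<Longrightarrow> u \<le> s' \<Longrightarrow> u \<in> cell Z t"
  by (fastforce simp: cell_def)

lemma cell_image:
  fixes h :: "real \<Rightarrow> real"
  assumes "strict_mono h"
  shows "h s \<in> cell (h ` Z) (h t) \<longleftrightarrow> s \<in> cell Z t"
  using assms by (simp add: cell_def strict_mono_less)

text \<open>A cell outside \<open>Z\<close> is an interval free of roots, so the intermediate value
  theorem forbids a change of sign.\<close>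

lemma sgn_poly_cell:
  fixes f :: "real poly"
  assumes roots: "\<forall>t. poly f t = 0 \<longrightarrow> t \<in> Z"
    and s: "s \<in> cell Z t"
  shows "sgn (poly f s) = sgn (poly f t)"
proof (cases "t \<in> Z")
  case True
  then show ?thesis using cell_mem s by metis
next
  case tZ: False
  have no: "poly f u \<noteq> 0" if "u \<in> cell Z t" for u
    using that roots cell_notin tZ by blast
  have aux: "\<not> poly f x * poly f y < 0" if "x < y" "x \<in> cell Z t" "y \<in> cell Z t" for x y
    using poly_IVT[OF that(1), of f] no cell_between that(2,3) by (meson less_imp_le)
  have "\<not> poly f s * poly f t < 0"
    using aux[of s t] aux[of t s] s cell_self[of t Z]
    by (cases s t rule: linorder_cases) (auto simp: mult.commute not_less)
  then show ?thesis using no[OF s] no[OF cell_self]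
    by (auto simp: sgn_if mult_less_0_iff)
qed

text \<open>Mean value theorem, combined with the constant sign of the derivative on the
  cell.\<close>

lemma poly_diff_cell:
  fixes f :: "real poly"
  assumes roots: "\<forall>t. poly (pderiv f) t = 0 \<longrightarrow> t \<in> Z"
    and "s \<in> cell Z t" "u \<in> cell Z t" 
  shows "sgn (poly f s - poly f u) = sgn (s - u) * sgn (poly (pderiv f) t)"
proof -
  have aux: "sgn (poly f y - poly f x) = sgn (y - x) * sgn (poly (pderiv f) t)"
    if xy: "x < y" "x \<in> cell Z t" "y \<in> cell Z t" for x y
  proof -
    obtain w where "x < w" "w < y" and w: "poly f y - poly f x = (y - x) * poly (pderiv f) w"
      using poly_MVT[OF xy(1)] by blast
    then have "w \<in> cell Z t" using cell_between[OF xy(2,3)] by simp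
    then show ?thesis using sgn_poly_cell[OF roots] w by (simp add: sgn_mult)
  qed
  show ?thesis
  proof (cases s u rule: linorder_cases)
    case less
    then have "sgn (poly f u - poly f s) = sgn (u - s) * sgn (poly (pderiv f) t)"
      using aux assms by blast
    then show ?thesis
      by (metis minus_diff_eq mult_minus_left sgn_minus)
  qed (use aux assms in auto)
qed

text \<open>Otherwise \<open>f\<close> would be bounded on a left half-line, while a nonconstant
  polynomial tends to infinity in absolute value.\<close>

lemma poly_unbounded_left:
  fixes f :: "real poly"
  assumes "pderiv f \<noteq> 0" "\<And>t. t \<le> T \<Longrightarrow> poly f t \<le> B"
  shows "\<exists>t\<le>T. poly f t < 0"
proof (rule ccontr)
  assume "\<not> ?thesis"
  then have "\<And>t. t \<le> T \<Longrightarrow> \<bar>poly f t\<bar> \<le> B" using assms(2) by (force simp: not_less)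
  then have bd: "\<forall>\<^sub>F t in at_bot. norm (poly f t) \<le> B"
    by (auto simp: eventually_at_bot_linorder)
  have "degree f > 0" using assms(1) by (auto simp: pderiv_eq_0_iff)
  then have "filterlim (poly f) at_infinity at_infinity"
    by (rule filterlim_poly_at_infinity)
  then have "filterlim (poly f) at_infinity at_bot"
    using filterlim_mono[OF _ order_refl at_bot_le_at_infinity] by blast
  then have "\<forall>\<^sub>F t in at_bot. norm (poly f t) \<ge> B + 1"
    by (auto simp: filterlim_at_infinity[OF order_refl] dest!: spec[of _ "\<bar>B\<bar> + 1"] elim: eventually_mono)
  with bd have "\<forall>\<^sub>F t in (at_bot::real filter). False"
    by eventually_elim simp
  then show False by simp
qed

section \<open>Signs that occur on a cell\<close>

text \<open>A relation, because a cell unbounded to the left has no left end. A condition on all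
  left ends then holds vacuously, which fits the limit -\<infinity> of a polynomial that increases
  there.\<close>

definition left_end :: "real set \<Rightarrow> real \<Rightarrow> real \<Rightarrow> bool" where
  "left_end Z t a \<longleftrightarrow> a \<in> Z \<and> a < t \<and> (\<forall>z\<in>Z. z < t \<longrightarrow> z \<le> a)"

definition right_end :: "real set \<Rightarrow> real \<Rightarrow> real \<Rightarrow> bool" where
  "right_end Z t a \<longleftrightarrow> a \<in> Z \<and> t < a \<and> (\<forall>z\<in>Z. t < z \<longrightarrow> a \<le> z)"

lemma left_end_image:
  fixes h :: "real \<Rightarrow> real"
  assumes "strict_mono h"
  shows "left_end (h ` Z) (h t) b \<longleftrightarrow> (\<exists>a. b = h a \<and> left_end Z t a)"
  using assms by (auto simp: left_end_def strict_mono_less strict_mono_less_eq)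

lemma right_end_image:
  fixes h :: "real \<Rightarrow> real"
  assumes "strict_mono h"
  shows "right_end (h ` Z) (h t) b \<longleftrightarrow> (\<exists>a. b = h a \<and> right_end Z t a)"
  using assms by (auto simp: right_end_def strict_mono_less strict_mono_less_eq)

text \<open>\<open>f\<close> increases strictly from the left end through the cell. Its infimum on
  the cell is the value at the left end, or -\<infinity> if there is none, and it is not attained;
  so nonpositive and negative values obey the same criterion.\<close>

lemma cell_neg_left_end:
  fixes f :: "real poly"
  assumes Z: "finite Z" and t0: "t0 \<notin> Z"
    and roots: "\<forall>t. poly (pderiv f) t = 0 \<longrightarrow> t \<in> Z"
    and pos: "poly (pderiv f) t0 > 0"
  shows "(\<exists>t\<in>cell Z t0. poly f t \<le> 0) \<Longrightarrow> \<forall>a. left_end Z t0 a \<longrightarrow> poly f a < 0"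
    and "\<forall>a. left_end Z t0 a \<longrightarrow> poly f a < 0 \<Longrightarrow> \<exists>t\<in>cell Z t0. poly f t < 0"
proof -
  have pos': "poly (pderiv f) t > 0" if "t \<in> cell Z t0" for t
    using sgn_poly_cell[OF roots that] pos by (metis sgn_greater)
  have end_cell: "u \<in> cell Z t0" if "left_end Z t0 a" "t \<in> cell Z t0" "a < u" "u \<le> t" for a t u
  proof -
    have "(z < t0 \<longleftrightarrow> z < u) \<and> (t0 < z \<longleftrightarrow> u < z)" if z: "z \<in> Z" for z
    proof -
      have "z < t0 \<longleftrightarrow> z < t" "t0 < z \<longleftrightarrow> t < z" "z < t0 \<Longrightarrow> z \<le> a" "z \<noteq> t0" "a < t0"
        using \<open>left_end Z t0 a\<close> \<open>t \<in> cell Z t0\<close> z t0 by (auto simp: left_end_def cell_def)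
      then show ?thesis using \<open>a < u\<close> \<open>u \<le> t\<close> by linarith
    qed
    then show ?thesis by (simp add: cell_def)
  qed
  have incr: "poly f x < poly f y" if xy: "left_end Z t0 a" "x < y" "a \<le> x" "y \<in> cell Z t0" for a x y
  proof -
    obtain w where w: "x < w" "w < y" and "poly f y - poly f x = (y - x) * poly (pderiv f) w"
      using poly_MVT[OF xy(2)] by blast
    moreover have "w \<in> cell Z t0" using end_cell[OF xy(1,4)] w xy(3) by simp
    ultimately show ?thesis using pos'[of w] xy(2)
      by (metis diff_gt_0_iff_gt mult_pos_pos)
  qed
  show "\<forall>a. left_end Z t0 a \<longrightarrow> poly f a < 0" if ex: "\<exists>t\<in>cell Z t0. poly f t \<le> 0"
  proof (intro allI impI)
    fix a assume a: "left_end Z t0 a"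
    obtain t where t: "t \<in> cell Z t0" "poly f t \<le> 0" using ex by blast
    have "a < t" using a t(1) by (auto simp: left_end_def cell_def)
    then show "poly f a < 0" using incr[OF a _ order_refl t(1)] t(2) by force
  qed
  assume neg: "\<forall>a. left_end Z t0 a \<longrightarrow> poly f a < 0"
  show "\<exists>t\<in>cell Z t0. poly f t < 0"
  proof (cases "\<exists>z\<in>Z. z < t0")
    \<comment> \<open>The cell is unbounded to the left, and \<open>poly f t0\<close> bounds
      \<open>f\<close> from above to the left of \<open>t0\<close>.\<close>
    case False
    have above: "t0 < z" if "z \<in> Z" for z
      using that False t0 by (metis linorder_neqE_linordered_idom)
    have left: "t \<in> cell Z t0" if "t \<le> t0" for t
      using that above by (force simp: cell_def)
    have "poly f t \<le> poly f t0" if "t \<le> t0" for t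
    proof -
      have "sgn (poly f t0 - poly f t) = sgn (t0 - t)"
        using poly_diff_cell[OF roots cell_self left[OF that]] pos by simp
      then have "sgn (poly f t0 - poly f t) \<ge> 0" using that by simp
      then show ?thesis by (simp only: zero_le_sgn_iff)
    qed
    moreover have "pderiv f \<noteq> 0" using pos by auto
    ultimately show ?thesis using poly_unbounded_left left by blast
  next
    case True
    define a where "a = Max {z\<in>Z. z < t0}"
    have "a \<in> {z\<in>Z. z < t0}" unfolding a_def using Z True by (intro Max_in) auto
    then have a: "left_end Z t0 a"
      using Z by (auto simp: left_end_def a_def)
    then have a': "a < t0" "poly f a < 0" using neg by (auto simp: left_end_def)
    show ?thesis
    proof (cases "poly f t0 < 0")
      case True
      then show ?thesis using cell_self by blast
    next
      case False
      then obtain r where r: "a < r" "r \<le> t0" "poly f r = 0"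
        using poly_IVT_pos[OF a'(1,2)] by (metis less_imp_le linorder_neqE_linordered_idom order_refl a'(1))
      have rc: "r \<in> cell Z t0" using end_cell[OF a cell_self r(1,2)] .
      have "(a + r) / 2 \<in> cell Z t0" using end_cell[OF a rc] r(1) by simp
      moreover have "poly f ((a + r) / 2) < 0" using incr[OF a _ _ rc, of "(a+r)/2"] r by simp
      ultimately show ?thesis by blast
    qed
  qed
qed

text \<open>The reflection \<open>g t = - f (- t)\<close> is again increasing and exchanges left and
  right ends, so the previous lemma applies to it.\<close>

lemma cell_pos_right_end:
  fixes f :: "real poly"
  assumes Z: "finite Z" and t0: "t0 \<notin> Z"
    and roots: "\<forall>t. poly (pderiv f) t = 0 \<longrightarrow> t \<in> Z"
    and pos: "poly (pderiv f) t0 > 0"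
  shows "(\<exists>t\<in>cell Z t0. poly f t \<ge> 0) \<Longrightarrow> \<forall>a. right_end Z t0 a \<longrightarrow> poly f a > 0"
    and "\<forall>a. right_end Z t0 a \<longrightarrow> poly f a > 0 \<Longrightarrow> \<exists>t\<in>cell Z t0. poly f t > 0"
proof -
  define g where "g = - pcompose f [:0, -1:]"
  have g: "poly g t = - poly f (- t)" "poly (pderiv g) t = poly (pderiv f) (- t)" for t
    by (simp_all add: g_def poly_pcompose pderiv_minus pderiv_pcompose pderiv_pCons)
  have uZ: "t \<in> uminus ` Z \<longleftrightarrow> - t \<in> Z" for t
    by (metis add.inverse_inverse image_iff)
  have cell: "t \<in> cell (uminus ` Z) (- t0) \<longleftrightarrow> - t \<in> cell Z t0" for t
  proof -
    have "- z < s \<longleftrightarrow> - s < z" "s < - z \<longleftrightarrow> z < - s" for z s :: real by linarith+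
    then show ?thesis by (simp add: cell_def) blast
  qed
  have end_iff: "left_end (uminus ` Z) (- t0) a \<longleftrightarrow> right_end Z t0 (- a)" for a
  proof -
    have "- z < s \<longleftrightarrow> - s < z" "s < - z \<longleftrightarrow> z < - s" "- z \<le> s \<longleftrightarrow> - s \<le> z" for z s :: real by linarith+
    then show ?thesis unfolding left_end_def right_end_def uZ by simp
  qed
  have t0': "- t0 \<notin> uminus ` Z" using t0 by auto
  have roots': "\<forall>t. poly (pderiv g) t = 0 \<longrightarrow> t \<in> uminus ` Z"
    using roots g uZ by auto
  have pos': "poly (pderiv g) (- t0) > 0" using pos g by simp
  note L = cell_neg_left_end[OF finite_imageI[OF Z] t0' roots' pos']
  show "\<forall>a. right_end Z t0 a \<longrightarrow> poly f a > 0" if ex: "\<exists>t\<in>cell Z t0. poly f t \<ge> 0"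
  proof -
    obtain t where "t \<in> cell Z t0" "poly f t \<ge> 0" using ex by blast
    then have "\<exists>t\<in>cell (uminus ` Z) (- t0). poly g t \<le> 0"
      by (intro bexI[of _ "- t"]) (auto simp: g cell)
    then have *: "\<forall>a. right_end Z t0 (- a) \<longrightarrow> poly f (- a) > 0"
      using L(1) by (simp add: g end_iff)
    then show ?thesis by (metis add.inverse_inverse)
  qed
  show "\<exists>t\<in>cell Z t0. poly f t > 0" if "\<forall>a. right_end Z t0 a \<longrightarrow> poly f a > 0"
  proof -
    have "\<exists>t\<in>cell (uminus ` Z) (- t0). poly g t < 0"
      using L(2) that by (simp add: g end_iff)
    then show ?thesis by (auto simp: g cell)
  qed
qed

text \<open>The criterion consults \<open>f\<close> only at points of \<open>Z\<close>, which makes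
  it transportable. The sign 0 requires both end conditions, and then the intermediate value theorem
  yields a root.\<close>

lemma cell_sgn_occurs:
  fixes f :: "real poly"
  assumes Z: "finite Z" and t0: "t0 \<notin> Z"
    and roots: "\<forall>t. poly (pderiv f) t = 0 \<longrightarrow> t \<in> Z"
    and pos: "poly (pderiv f) t0 > 0"
  shows "(\<exists>t\<in>cell Z t0. sgn (poly f t) = \<sigma>) \<longleftrightarrow>
    \<sigma> \<in> {-1, 0, 1} \<and>
    (\<sigma> \<le> 0 \<longrightarrow> (\<forall>a. left_end Z t0 a \<longrightarrow> sgn (poly f a) = -1)) \<and>
    (\<sigma> \<ge> 0 \<longrightarrow> (\<forall>a. right_end Z t0 a \<longrightarrow> sgn (poly f a) = 1))"
    (is "?L \<longleftrightarrow> ?R")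
proof
  note neg = cell_neg_left_end[OF Z t0 roots pos] and pos = cell_pos_right_end[OF Z t0 roots pos]
  show ?R if L: ?L
  proof -
    obtain t where t: "t \<in> cell Z t0" "sgn (poly f t) = \<sigma>" using L by blast
    have "\<sigma> \<in> {-1, 0, 1}" using t(2) by (cases "poly f t" "0::real" rule: linorder_cases) auto
    moreover have "\<forall>a. left_end Z t0 a \<longrightarrow> sgn (poly f a) = -1" if "\<sigma> \<le> 0"
      using neg(1) t that by (metis sgn_le_0_iff sgn_neg)
    moreover have "\<forall>a. right_end Z t0 a \<longrightarrow> sgn (poly f a) = 1" if "\<sigma> \<ge> 0"
      using pos(1) t that by (metis zero_le_sgn_iff sgn_pos)
    ultimately show ?thesis by blast
  qed
  assume R: ?R
  have neg': "\<exists>t\<in>cell Z t0. poly f t < 0" if "\<sigma> \<le> 0"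
  proof (rule neg(2), intro allI impI)
    fix a assume "left_end Z t0 a"
    then have "sgn (poly f a) < 0" using R that by simp
    then show "poly f a < 0" by (simp only: sgn_less)
  qed
  have pos': "\<exists>t\<in>cell Z t0. poly f t > 0" if "\<sigma> \<ge> 0"
  proof (rule pos(2), intro allI impI)
    fix a assume "right_end Z t0 a"
    then have "0 < sgn (poly f a)" using R that by simp
    then show "0 < poly f a" by (simp only: sgn_greater)
  qed
  consider "\<sigma> = -1" | "\<sigma> = 1" | "\<sigma> = 0" using R by blast
  then show ?L
  proof cases
    case 1 then show ?thesis using neg' sgn_neg by fastforce
  next
    case 2 then show ?thesis using pos' sgn_pos by fastforce
  next
    case 3
    obtain x y where xy: "x \<in> cell Z t0" "poly f x < 0" "y \<in> cell Z t0" "poly f y > 0"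
      using neg' pos' 3 by auto
    then have "\<exists>r\<in>cell Z t0. poly f r = 0"
    proof (cases x y rule: linorder_cases)
      case less
      then show ?thesis using poly_IVT_pos[OF less xy(2,4)] cell_between[OF xy(1,3)] by force
    next
      case greater
      then show ?thesis using poly_IVT_neg[OF greater xy(4,2)] cell_between[OF xy(3,1)] by force
    qed (use xy in auto)
    then show ?thesis using 3 by force
  qed
qed

text \<open>The signs taken on a cell depend only on those at its end points, and \<open>h\<close>
  maps end points to end points. A decreasing pair is handled by negating both polynomials.\<close>

lemma cell_sgn_occurs_image:
  fixes f g :: "real poly" and h :: "real \<Rightarrow> real"
  assumes Z: "finite Z" and t0: "t0 \<notin> Z" and h: "strict_mono h"
    and rf: "\<forall>t. poly (pderiv f) t = 0 \<longrightarrow> t \<in> Z"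
    and rg: "\<forall>t. poly (pderiv g) t = 0 \<longrightarrow> t \<in> h ` Z"
    and sd: "sgn (poly (pderiv f) t0) = sgn (poly (pderiv g) (h t0))"
    and sZ: "\<And>a. a \<in> Z \<Longrightarrow> sgn (poly f a) = sgn (poly g (h a))"
  shows "(\<exists>t\<in>cell Z t0. sgn (poly f t) = \<sigma>) \<longleftrightarrow> (\<exists>s\<in>cell (h ` Z) (h t0). sgn (poly g s) = \<sigma>)"
proof -
  have aux: "(\<exists>t\<in>cell Z t0. sgn (poly f t) = \<sigma>) \<longleftrightarrow> (\<exists>s\<in>cell (h ` Z) (h t0). sgn (poly g s) = \<sigma>)"
    if rf: "\<forall>t. poly (pderiv f) t = 0 \<longrightarrow> t \<in> Z"
    and rg: "\<forall>t. poly (pderiv g) t = 0 \<longrightarrow> t \<in> h ` Z"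
    and pf: "poly (pderiv f) t0 > 0" and pg: "poly (pderiv g) (h t0) > 0"
    and sZ: "\<And>a. a \<in> Z \<Longrightarrow> sgn (poly f a) = sgn (poly g (h a))" for f g :: "real poly" and \<sigma>
  proof -
    have ht0: "h t0 \<notin> h ` Z" using t0 h by (auto simp: strict_mono_eq)
    have "left_end Z t0 a \<Longrightarrow> a \<in> Z" "right_end Z t0 a \<Longrightarrow> a \<in> Z" for a
      by (auto simp: left_end_def right_end_def)
    then have
      "(\<forall>b. left_end (h ` Z) (h t0) b \<longrightarrow> sgn (poly g b) = -1) \<longleftrightarrow>
       (\<forall>a. left_end Z t0 a \<longrightarrow> sgn (poly f a) = -1)"
      "(\<forall>b. right_end (h ` Z) (h t0) b \<longrightarrow> sgn (poly g b) = 1) \<longleftrightarrow>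
       (\<forall>a. right_end Z t0 a \<longrightarrow> sgn (poly f a) = 1)"
      unfolding left_end_image[OF h] right_end_image[OF h] using sZ by metis+
    then show ?thesis
      unfolding cell_sgn_occurs[OF Z t0 rf pf] cell_sgn_occurs[OF finite_imageI[OF Z] ht0 rg pg]
      by simp
  qed
  have "poly (pderiv f) t0 \<noteq> 0" using rf t0 by blast
  then consider "poly (pderiv f) t0 > 0" "poly (pderiv g) (h t0) > 0"
    | "poly (pderiv f) t0 < 0" "poly (pderiv g) (h t0) < 0"
    using sd by (metis linorder_neqE_linordered_idom sgn_greater sgn_less)
  then show ?thesis
  proof cases
    case 1
    then show ?thesis using aux rf rg sZ by blast
  next
    case 2
    have "(\<exists>t\<in>cell Z t0. sgn (poly (- f) t) = - \<sigma>) \<longleftrightarrow>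
      (\<exists>s\<in>cell (h ` Z) (h t0). sgn (poly (- g) s) = - \<sigma>)"
      by (rule aux) (use rf rg sZ 2 in \<open>auto simp: pderiv_minus sgn_minus\<close>)
    then show ?thesis by (simp add: sgn_minus)
  qed
qed

text \<open>
  Between consecutive roots of the \<open>P i\<close> the polynomial \<open>f\<close> is strictly monotone, so the signs it
  takes there depend only on its signs at the two end points; these agree with those of \<open>g\<close> by
  assumption.
\<close>

lemma sign_matching_step:
  fixes P Q :: "'i \<Rightarrow> real poly" and f g :: "real poly"
  assumes I: "finite I" and h: "strict_mono h" "surj h"
    and PQ: "\<And>i t. i \<in> I \<Longrightarrow> sgn (poly (P i) t) = sgn (poly (Q i) (h t))"
    and k: "k \<in> I" "P k = pderiv f" "Q k = pderiv g" "pderiv f \<noteq> 0"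
    and root: "\<And>i t. i \<in> I \<Longrightarrow> P i \<noteq> 0 \<Longrightarrow> poly (P i) t = 0 \<Longrightarrow> sgn (poly f t) = sgn (poly g (h t))"
  shows "\<exists>h'. strict_mono h' \<and> surj h' \<and> (\<forall>i\<in>I. \<forall>t. sgn (poly (P i) t) = sgn (poly (Q i) (h' t))) \<and>
              (\<forall>t. sgn (poly f t) = sgn (poly g (h' t)))"
proof -
  define Z where "Z = {t. \<exists>i\<in>I. P i \<noteq> 0 \<and> poly (P i) t = 0}"
  have "Z = (\<Union>i\<in>{i\<in>I. P i \<noteq> 0}. {t. poly (P i) t = 0})" by (auto simp: Z_def)
  then have finZ: "finite Z" using I by (auto intro: poly_roots_finite)
  have sZ: "sgn (poly f a) = sgn (poly g (h a))" if "a \<in> Z" for a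
    using that root by (auto simp: Z_def)
  have zero: "poly (P i) t = 0 \<longleftrightarrow> poly (Q i) (h t) = 0" if "i \<in> I" for i t
    using PQ[OF that, of t] by (metis sgn_0_0)
  have Qz: "Q i = 0" if "i \<in> I" "P i = 0" for i
  proof -
    have "poly (Q i) s = 0" for s
      using zero[OF that(1)] that(2) h(2) by (metis poly_0 surj_def)
    then show ?thesis using poly_all_0_iff_0 by blast
  qed
  have rP: "\<forall>t. poly (P i) t = 0 \<longrightarrow> t \<in> Z" if "i \<in> I" "P i \<noteq> 0" for i
    using that by (auto simp: Z_def)
  have rQ: "\<forall>s. poly (Q i) s = 0 \<longrightarrow> s \<in> h ` Z" if "i \<in> I" "P i \<noteq> 0" for i
    using that rP zero h(2) by (metis image_iff surj_def)
  have rf: "\<forall>t. poly (pderiv f) t = 0 \<longrightarrow> t \<in> Z" using rP[of k] k by simp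
  have rg: "\<forall>s. poly (pderiv g) s = 0 \<longrightarrow> s \<in> h ` Z" using rQ[of k] k by simp
  have sd: "sgn (poly (pderiv f) t) = sgn (poly (pderiv g) (h t))" for t
    using PQ[OF k(1), of t] k by simp
  note occ = cell_sgn_occurs_image[OF finZ _ h(1) rf rg sd sZ]
  define N where "N = {t. poly f t = 0}"
  have "f \<noteq> 0" using k(4) by auto
  then have finN: "finite N" by (simp add: N_def poly_roots_finite)
  \<comment> \<open>\<open>h\<close> is kept on \<open>Z\<close>; any other root of \<open>f\<close>
    goes to a root of \<open>g\<close> in the corresponding cell, which exists because the sign 0
    occurs on both cells or on neither.\<close>
  define d where "d t = (if t \<in> Z then h t else SOME s. s \<in> cell (h ` Z) (h t) \<and> poly g s = 0)" for t
  have dZ: "d t = h t" if "t \<in> Z" for t using that by (simp add: d_def)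
  have dN: "d t \<in> cell (h ` Z) (h t) \<and> poly g (d t) = 0" if "t \<in> N" "t \<notin> Z" for t
  proof -
    have "\<exists>u\<in>cell Z t. sgn (poly f u) = 0" using that(1) cell_self by (force simp: N_def)
    then have "\<exists>s. s \<in> cell (h ` Z) (h t) \<and> poly g s = 0"
      using occ[OF that(2), of 0] by (auto simp: sgn_0_0)
    from someI_ex[OF this] show ?thesis using that(2) by (simp add: d_def)
  qed
  have dc: "d t \<in> cell (h ` Z) (h t)" if "t \<in> Z \<union> N" for t
    using that dZ dN cell_self by (cases "t \<in> Z") auto
  have "strict_mono_on (Z \<union> N) d"
  proof (rule strict_mono_onI)
    fix x y assume xy: "x \<in> Z \<union> N" "y \<in> Z \<union> N" "x < y"
    have *: "z \<in> Z \<Longrightarrow> z < y \<Longrightarrow> h z < d y" "z \<in> Z \<Longrightarrow> x < z \<Longrightarrow> d x < h z" for z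
      using dc[OF xy(1)] dc[OF xy(2)] h(1) by (auto simp: cell_def strict_mono_less)
    show "d x < d y"
    proof (cases "x \<in> Z \<or> y \<in> Z")
      case True
      then show ?thesis using * xy(3) dZ by auto
    next
      case False
      have "poly f x = 0" "poly f y = 0" using xy False by (auto simp: N_def)
      \<comment> \<open>Rolle: two roots of \<open>f\<close> outside \<open>Z\<close> are separated
        by a root of the derivative, hence by a point of \<open>Z\<close>.\<close>
      moreover obtain z where z: "x < z" "z < y" "poly f y - poly f x = (y - x) * poly (pderiv f) z"
        using poly_MVT[OF xy(3), of f] by blast
      ultimately have "poly (pderiv f) z = 0" using xy(3) by simp
      then show ?thesis using *[of z] rf z by fastforce
    qed
  qed
  then obtain h' where h': "strict_mono h'" "surj h'" and h'd: "\<And>w. w \<in> Z \<union> N \<Longrightarrow> h' w = d w"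
    using extend_strict_mono[of "Z \<union> N" d] finZ finN by blast
  have "h' ` Z = h ` Z" using h'd dZ by (intro image_cong) auto
  \<comment> \<open>Agreeing with \<open>h\<close> on \<open>Z\<close>, the map \<open>h'\<close>
    carries each cell into the same cell as \<open>h\<close> does, so the signs of the
    \<open>Q i\<close> do not change.\<close>
  have h'c: "h' t \<in> cell (h ` Z) (h t)" for t
  proof -
    have "h' z = h z" if "z \<in> Z" for z using h'd dZ that by simp
    then have "(h z < h t \<longleftrightarrow> h z < h' t) \<and> (h t < h z \<longleftrightarrow> h' t < h z)" if "z \<in> Z" for z
      using that strict_mono_less[OF h(1)] strict_mono_less[OF h'(1)] by metis
    then show ?thesis by (simp add: cell_def)
  qed
  have c1: "sgn (poly (P i) t) = sgn (poly (Q i) (h' t))" if "i \<in> I" for i t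
  proof (cases "P i = 0")
    case True
    then show ?thesis using Qz that by simp
  next
    case False
    then show ?thesis
      using PQ[OF that, of t] sgn_poly_cell[OF rQ[OF that False] h'c] by simp
  qed
  have c2: "sgn (poly f t) = sgn (poly g (h' t))" for t
  proof (cases "t \<in> Z")
    case True
    then show ?thesis using sZ h'd dZ by simp
  next
    case tZ: False
    show ?thesis
    proof (cases "\<exists>c\<in>cell Z t. poly f c = 0")
      case True
      \<comment> \<open>Both signs are read off from the position relative to the matched roots
        \<open>c\<close> and \<open>h' c\<close> and from the sign of the derivative.\<close>
      then obtain c where c: "c \<in> cell Z t" "poly f c = 0" by blast
      have cZ: "c \<notin> Z" using cell_notin[OF tZ c(1)] .
      have cN: "c \<in> N" using c by (simp add: N_def)
      have g0: "poly g (h' c) = 0" using dN[OF cN cZ] h'd cN by simp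
      have "h c \<in> cell (h ` Z) (h t)" using c(1) cell_image[OF h(1)] by simp
      then have c': "h' c \<in> cell (h ` Z) (h t)" using h'c[of c] cell_eq by blast
      have "sgn (poly f t) = sgn (t - c) * sgn (poly (pderiv f) t)"
        using poly_diff_cell[OF rf cell_self c(1)] c(2) by simp
      moreover have "sgn (poly g (h' t)) = sgn (h' t - h' c) * sgn (poly (pderiv g) (h t))"
        using poly_diff_cell[OF rg h'c c'] g0 by simp
      moreover have "sgn (t - c) = sgn (h' t - h' c)"
        using h'(1) by (cases t c rule: linorder_cases) (auto simp: strict_mono_less)
      ultimately show ?thesis using sd by simp
    next
      case False
      \<comment> \<open>Here \<open>f\<close> has constant sign on the cell, and the sign of
        \<open>g\<close> at \<open>h' t\<close> is one that \<open>f\<close> takes there.\<close>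
      have "\<exists>s\<in>cell (h ` Z) (h t). sgn (poly g s) = sgn (poly g (h' t))" using h'c by blast
      then obtain u where u: "u \<in> cell Z t" "sgn (poly f u) = sgn (poly g (h' t))"
        using occ[OF tZ] by blast
      have "sgn (poly f u) = sgn (poly f t)"
      proof -
        have ivt: "\<not> poly f x * poly f y < 0" if "x < y" "x \<in> cell Z t" "y \<in> cell Z t" for x y
          using poly_IVT[OF that(1), of f] False cell_between[OF that(2,3)] by (meson less_imp_le)
        then have "\<not> poly f u * poly f t < 0"
          using ivt[of u t] ivt[of t u] u(1) cell_self[of t Z]
          by (cases u t rule: linorder_cases) (auto simp: mult.commute not_less)
        moreover have "poly f u \<noteq> 0" "poly f t \<noteq> 0" using False u(1) cell_self by auto
        ultimately show ?thesis by (auto simp: sgn_if mult_less_0_iff)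
      qed
      then show ?thesis using u(2) by simp
    qed
  qed
  show ?thesis using h' c1 c2 by blast
qed

section \<open>Polynomials with parameters\<close>

locale fun_algebra =
  fixes F :: "('p \<Rightarrow> real) set"
  assumes const [intro]: "(\<lambda>p. c) \<in> F"
    and add [intro]: "\<And>f g. f \<in> F \<Longrightarrow> g \<in> F \<Longrightarrow> (\<lambda>p. f p + g p) \<in> F"
    and mult [intro]: "\<And>f g. f \<in> F \<Longrightarrow> g \<in> F \<Longrightarrow> (\<lambda>p. f p * g p) \<in> F"
begin

lemma diff [intro]: "f \<in> F \<Longrightarrow> g \<in> F \<Longrightarrow> (\<lambda>p. f p - g p) \<in> F"
  using add[of f "\<lambda>p. -1 * g p"] mult[OF const[of "-1"], of g] by simp

lemma sum [intro]: "(\<And>i. i \<in> I \<Longrightarrow> f i \<in> F) \<Longrightarrow> (\<lambda>p. \<Sum>i\<in>I. f i p) \<in> F"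
  by (induction I rule: infinite_finite_induct) auto

lemma prod [intro]: "(\<And>i. i \<in> I \<Longrightarrow> f i \<in> F) \<Longrightarrow> (\<lambda>p. \<Prod>i\<in>I. f i p) \<in> F"
  by (induction I rule: infinite_finite_induct) auto

lemma power [intro]: "f \<in> F \<Longrightarrow> (\<lambda>p. f p ^ n) \<in> F"
  by (induction n) auto

definition sgn_equal :: "('p \<Rightarrow> real) set \<Rightarrow> 'p \<Rightarrow> 'p \<Rightarrow> bool" where
  "sgn_equal L p q \<longleftrightarrow> (\<forall>a\<in>L. sgn (a p) = sgn (a q))"

lemma sgn_equal_Un: "sgn_equal (L \<union> L') p q \<longleftrightarrow> sgn_equal L p q \<and> sgn_equal L' p q"
  by (auto simp: sgn_equal_def)

lemma sgn_equal_UN: "sgn_equal (\<Union>i\<in>I. L i) p q \<longleftrightarrow> (\<forall>i\<in>I. sgn_equal (L i) p q)"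
  by (auto simp: sgn_equal_def)

text \<open>
  The number \<open>n\<close> is a formal degree: the coefficient of index \<open>n\<close> may vanish at some or all parameters.
\<close>

definition param_poly :: "nat \<Rightarrow> ('p \<Rightarrow> real poly) \<Rightarrow> bool" where
  "param_poly n P \<longleftrightarrow> (\<forall>i. (\<lambda>p. coeff (P p) i) \<in> F) \<and> (\<forall>p. \<forall>i>n. coeff (P p) i = 0)"

lemma param_poly_monom:
  assumes "f \<in> F"
  shows "param_poly n (\<lambda>p. monom (f p) n)"
proof -
  have "(\<lambda>p. coeff (monom (f p) n) i) \<in> F" for i
    using assms by (cases "n = i") auto
  then show ?thesis by (simp add: param_poly_def)
qed

lemma param_poly_const: "f \<in> F \<Longrightarrow> param_poly 0 (\<lambda>p. [:f p:])"
  using param_poly_monom[of f 0] by (simp add: monom_0)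

lemma param_poly_mono: "param_poly m P \<Longrightarrow> m \<le> n \<Longrightarrow> param_poly n P"
  by (auto simp: param_poly_def)

lemma param_poly_add: "param_poly n P \<Longrightarrow> param_poly n Q \<Longrightarrow> param_poly n (\<lambda>p. P p + Q p)"
  by (auto simp: param_poly_def)

lemma param_poly_diff: "param_poly n P \<Longrightarrow> param_poly n Q \<Longrightarrow> param_poly n (\<lambda>p. P p - Q p)"
  by (auto simp: param_poly_def)

lemma param_poly_mult:
  assumes "param_poly m P" "param_poly n Q"
  shows "param_poly (m + n) (\<lambda>p. P p * Q p)"
  unfolding param_poly_def
proof (intro conjI allI impI)
  show "(\<lambda>p. coeff (P p * Q p) i) \<in> F" for i
    unfolding coeff_mult using assms by (intro sum mult) (auto simp: param_poly_def)
  fix p i assume i: "m + n < i"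
  have "coeff (P p) j * coeff (Q p) (i - j) = 0" if "j \<le> i" for j
    using assms i by (cases "j \<le> m") (auto simp: param_poly_def)
  then show "coeff (P p * Q p) i = 0" unfolding coeff_mult by (intro sum.neutral) simp
qed

lemma param_poly_smult: "f \<in> F \<Longrightarrow> param_poly n P \<Longrightarrow> param_poly n (\<lambda>p. smult (f p) (P p))"
  by (auto simp: param_poly_def)

lemma param_poly_pderiv: "param_poly n P \<Longrightarrow> param_poly (n - 1) (\<lambda>p. pderiv (P p))"
  by (auto simp: param_poly_def coeff_pderiv)

lemma param_poly_coeff: "param_poly n P \<Longrightarrow> (\<lambda>p. coeff (P p) i) \<in> F"
  by (auto simp: param_poly_def)

lemma param_poly_pred:
  assumes "param_poly n P" "\<And>p. coeff (P p) n = 0"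
  shows "param_poly (n - 1) P"
  unfolding param_poly_def
proof (intro conjI allI impI)
  fix p i assume "n - 1 < i"
  then show "coeff (P p) i = 0" using assms by (cases "i = n") (auto simp: param_poly_def)
qed (use assms in \<open>auto simp: param_poly_def\<close>)

text \<open>Meant for parameters at which the top coefficient vanishes: the polynomial is unchanged
  there, but the formal degree drops.\<close>

definition truncate :: "nat \<Rightarrow> ('p \<Rightarrow> real poly) \<Rightarrow> 'p \<Rightarrow> real poly" where
  "truncate n P = (\<lambda>p. P p - monom (coeff (P p) n) n)"

lemma param_poly_truncate: "param_poly n P \<Longrightarrow> param_poly (n - 1) (truncate n P)"
  unfolding truncate_def
  by (intro param_poly_pred param_poly_diff param_poly_monom param_poly_coeff) auto

text \<open>
  A single step of pseudo-division of \<open>P\<close> by \<open>Q\<close>. It suffices, because at a root of \<open>Q p\<close> the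
  sign of \<open>P p\<close> can be read off from the result and the leading coefficient of \<open>Q p\<close>, and the
  formal degree drops below \<open>n\<close>.
\<close>

definition reduce :: "nat \<Rightarrow> ('p \<Rightarrow> real poly) \<Rightarrow> nat \<Rightarrow> ('p \<Rightarrow> real poly) \<Rightarrow> 'p \<Rightarrow> real poly" where
  "reduce n P k Q =
     (\<lambda>p. smult (coeff (Q p) k) (P p) - monom (coeff (P p) n) (n - k) * Q p)"

lemma param_poly_reduce:
  assumes "param_poly n P" "param_poly k Q" "k \<le> n"
  shows "param_poly (n - 1) (reduce n P k Q)"
proof (rule param_poly_pred)
  have "param_poly (n - k + k) (\<lambda>p. monom (coeff (P p) n) (n - k) * Q p)"
    using assms by (intro param_poly_mult param_poly_monom param_poly_coeff)
  then show "param_poly n (reduce n P k Q)"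
    unfolding reduce_def using assms
    by (intro param_poly_diff param_poly_smult param_poly_coeff[of k]) auto
  show "coeff (reduce n P k Q p) n = 0" for p
    using assms(3) by (simp add: reduce_def coeff_monom_mult)
qed

text \<open>Equality of sign diagrams up to a reparametrization of the line; one \<open>h\<close>
  serves all of \<open>M\<close>, but it may vary with \<open>p\<close> and
  \<open>q\<close>.\<close>

definition sgn_match :: "('p \<Rightarrow> real poly) set \<Rightarrow> 'p \<Rightarrow> 'p \<Rightarrow> bool" where
  "sgn_match M p q \<longleftrightarrow> (\<exists>h. strict_mono h \<and> surj h \<and>
     (\<forall>P\<in>M. \<forall>t. sgn (poly (P p) t) = sgn (poly (P q) (h t))))"

text \<open>At a root of \<open>g p\<close> the reduction of \<open>f\<close> by \<open>g\<close> is
  the top coefficient of \<open>g p\<close> times \<open>f p\<close>. The matched signs of the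
  reductions thus supply the signs of \<open>f\<close> that \<open>sign_matching_step\<close> asks
  for.\<close>

lemma sgn_match_add_poly:
  assumes f: "param_poly n f" "n \<ge> 1" and N: "finite N"
    and lf: "coeff (f p) n \<noteq> 0"
    and df: "(n - 1, \<lambda>p. pderiv (f p)) \<in> N"
    and NP: "\<And>k g. (k, g) \<in> N \<Longrightarrow> param_poly k g"
    and lN: "\<And>k g. (k, g) \<in> N \<Longrightarrow> k \<ge> 1 \<Longrightarrow> coeff (g p) k \<noteq> 0"
    and sl: "\<And>k g. (k, g) \<in> N \<Longrightarrow> sgn (coeff (g p) k) = sgn (coeff (g q) k)"
    and m: "sgn_match (snd ` N \<union> (\<lambda>(k, g). reduce n f k g) ` N) p q"
  shows "sgn_match (insert f (snd ` N)) p q"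
proof -
  obtain h where h: "strict_mono h" "surj h"
    and hN: "\<And>k g t. (k, g) \<in> N \<Longrightarrow> sgn (poly (g p) t) = sgn (poly (g q) (h t))"
    and hR: "\<And>k g t. (k, g) \<in> N \<Longrightarrow> sgn (poly (reduce n f k g p) t) = sgn (poly (reduce n f k g q) (h t))"
  proof -
    obtain h where h: "strict_mono h" "surj h" and *: "\<forall>P\<in>snd ` N \<union> (\<lambda>(k, g). reduce n f k g) ` N.
        \<forall>t. sgn (poly (P p) t) = sgn (poly (P q) (h t))"
      using m unfolding sgn_match_def by blast
    show thesis
    proof (rule that[OF h])
      fix k g t assume "(k, g) \<in> N"
      then have "g \<in> snd ` N" "reduce n f k g \<in> (\<lambda>(k, g). reduce n f k g) ` N"
        by force+
      then show "sgn (poly (g p) t) = sgn (poly (g q) (h t))"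
        "sgn (poly (reduce n f k g p) t) = sgn (poly (reduce n f k g q) (h t))"
        using * by blast+
    qed
  qed
  have root: "sgn (poly (f p) t) = sgn (poly (f q) (h t))"
    if i: "(k, g) \<in> N" "g p \<noteq> 0" and r: "poly (g p) t = 0" for k g t
  proof -
    have k: "k \<ge> 1"
    proof (rule ccontr)
      assume "\<not> k \<ge> 1"
      then have "degree (g p) = 0"
        using NP[OF i(1)] degree_le[of 0 "g p"] by (simp add: param_poly_def)
      then obtain c where "g p = [:c:]" by (rule degree_eq_zeroE)
      then show False using i(2) r by simp
    qed
    have r': "poly (g q) (h t) = 0" using hN[OF i(1), of t] r by (simp add: sgn_0_0)
    let ?b = "\<lambda>p. coeff (g p) k"
    have "sgn (?b p) * sgn (poly (f p) t) = sgn (?b q) * sgn (poly (f q) (h t))"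
      using hR[OF i(1), of t] r r' by (simp add: reduce_def sgn_mult)
    moreover have "sgn (?b q) \<noteq> 0"
      using sl[OF i(1)] lN[OF i(1) k] by (metis sgn_0_0)
    ultimately show ?thesis using sl[OF i(1)] by simp
  qed
  have df0: "pderiv (f p) \<noteq> 0"
  proof -
    have "coeff (pderiv (f p)) (n - 1) \<noteq> 0" using f(2) lf by (simp add: coeff_pderiv)
    then show ?thesis by auto
  qed
  have "\<exists>h'. strict_mono h' \<and> surj h' \<and>
      (\<forall>i\<in>N. \<forall>t. sgn (poly (snd i p) t) = sgn (poly (snd i q) (h' t))) \<and>
      (\<forall>t. sgn (poly (f p) t) = sgn (poly (f q) (h' t)))"
  proof (rule sign_matching_step[OF N h])
    show "sgn (poly (snd i p) t) = sgn (poly (snd i q) (h t))" if "i \<in> N" for i t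
      using hN that by (metis prod.collapse)
    show "sgn (poly (f p) t) = sgn (poly (f q) (h t))"
      if "i \<in> N" "snd i p \<noteq> 0" "poly (snd i p) t = 0" for i t
      using root that by (metis prod.collapse)
  qed (use df df0 in auto)
  then show ?thesis unfolding sgn_match_def by auto
qed

text \<open>The descent that permits trading one polynomial for many of lower formal degree.\<close>

lemma mset_image_decrease:
  fixes n :: nat
  assumes "\<forall>k\<in>#K. k < n"
  shows "M + K < add_mset n M"
  using one_step_implies_multp[of "{#n#}" K "(<)" M] assms by (simp add: less_multiset_def)

text \<open>
  Induction on the multiset of formal degrees. A vanishing leading coefficient allows one to truncate.
  Otherwise a polynomial \<open>f\<close> of maximal degree is replaced by its derivative and its reductions modulo
  the derivative and the remaining polynomials, all of which have smaller degree.
\<close>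

theorem sgn_match_determined:
  fixes M :: "(nat \<times> ('p \<Rightarrow> real poly)) multiset"
  assumes "\<And>k g. (k, g) \<in># M \<Longrightarrow> param_poly k g"
  shows "\<exists>L. finite L \<and> L \<subseteq> F \<and> (\<forall>p q. sgn_equal L p q \<longrightarrow> sgn_match (snd ` set_mset M) p q)"
  using assms
proof (induction "image_mset fst M" arbitrary: M rule: less_induct)
  case less
  note IH = less.hyps and PP = less.prems
  define lc where "lc = (\<lambda>(k, g :: 'p \<Rightarrow> real poly) p. coeff (g p) k)"
  have lcF: "lc ` set_mset M \<subseteq> F" using PP by (auto simp: lc_def intro: param_poly_coeff)
  show ?case
  proof (cases "\<exists>i\<in>#M. fst i \<ge> 1")
    case False
    \<comment> \<open>All polynomials are constant in the variable, so the identity matches them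
      once the constants agree in sign.\<close>
    have "sgn_match (snd ` set_mset M) p q" if "sgn_equal (lc ` set_mset M) p q" for p q
    proof -
      have "sgn (poly (g p) t) = sgn (poly (g q) t)" if i: "(k, g) \<in># M" for k g t
      proof -
        have k: "k = 0" using False i by fastforce
        have "poly (g r) t = coeff (g r) 0" for r
        proof -
          have "degree (g r) = 0"
            using PP[OF i] k degree_le[of 0 "g r"] by (simp add: param_poly_def)
          then obtain c where "g r = [:c:]" by (rule degree_eq_zeroE)
          then show ?thesis by simp
        qed
        then show ?thesis
          using \<open>sgn_equal (lc ` set_mset M) p q\<close> i k by (force simp: sgn_equal_def lc_def)
      qed
      moreover have "strict_mono (\<lambda>t::real. t)" by (simp add: strict_mono_def)
      ultimately show ?thesis
        unfolding sgn_match_def by (intro exI[of _ "\<lambda>t. t"]) auto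
    qed
    then show ?thesis using lcF by (intro exI[of _ "lc ` set_mset M"]) auto
  next
    case True
    define n where "n = Max (fst ` set_mset M)"
    have n_max: "k \<le> n" if "(k, g) \<in># M" for k g
      unfolding n_def using that by (intro Max_ge) force+
    have "n \<in> fst ` set_mset M" unfolding n_def using True by (intro Max_in) auto
    then obtain f where f: "(n, f) \<in># M" by auto
    have n1: "n \<ge> 1" using True n_max by fastforce
    define trunc where "trunc = (\<lambda>i :: nat \<times> ('p \<Rightarrow> real poly).
      add_mset (fst i - 1, truncate (fst i) (snd i)) (M - {#i#}))"
    have "\<exists>L. finite L \<and> L \<subseteq> F \<and>
        (\<forall>p q. sgn_equal L p q \<longrightarrow> sgn_match (snd ` set_mset (trunc i)) p q)"
      if i: "i \<in># M" "fst i \<ge> 1" for i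
    proof (rule IH)
      have "image_mset fst (M - {#i#}) + {#fst i - 1#} < add_mset (fst i) (image_mset fst (M - {#i#}))"
        using i(2) by (intro mset_image_decrease) auto
      also have "\<dots> = image_mset fst M" using i(1) by (metis image_mset_add_mset insert_DiffM)
      finally show "image_mset fst (trunc i) < image_mset fst M" by (simp add: trunc_def)
      show "param_poly k g" if "(k, g) \<in># trunc i" for k g
        using that PP i(1) param_poly_truncate
        by (auto simp: trunc_def dest: in_diffD)
    qed
    then obtain Lt where Lt: "\<And>i. i \<in># M \<Longrightarrow> fst i \<ge> 1 \<Longrightarrow> finite (Lt i) \<and> Lt i \<subseteq> F \<and>
        (\<forall>p q. sgn_equal (Lt i) p q \<longrightarrow> sgn_match (snd ` set_mset (trunc i)) p q)"
      by metis
    define M0 where "M0 = M - {#(n, f)#}"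
    have M: "M = add_mset (n, f) M0" using f by (simp add: M0_def)
    define N where "N = add_mset (n - 1, \<lambda>p. pderiv (f p)) M0"
    define M' where "M' = N + image_mset (\<lambda>(k, g). (n - 1, reduce n f k g)) N"
    have N_le: "k \<le> n" and N_PP: "param_poly k g" if "(k, g) \<in># N" for k g
      using that n_max PP f M param_poly_pderiv[of n f] by (auto simp: N_def)
    have "\<exists>L. finite L \<and> L \<subseteq> F \<and> (\<forall>p q. sgn_equal L p q \<longrightarrow> sgn_match (snd ` set_mset M') p q)"
    proof (rule IH)
      have "image_mset fst M' = image_mset fst M0 +
          (add_mset (n - 1) (image_mset (\<lambda>i. n - 1) N))"
        by (simp add: M'_def N_def image_mset.compositionality comp_def case_prod_beta)
      also have "\<dots> < add_mset n (image_mset fst M0)"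
        using n1 by (intro mset_image_decrease) auto
      finally show "image_mset fst M' < image_mset fst M" by (simp add: M)
      show "param_poly k g" if "(k, g) \<in># M'" for k g
        using that N_PP N_le PP[OF f] param_poly_reduce by (auto simp: M'_def)
    qed
    then obtain L' where L': "finite L'" "L' \<subseteq> F"
      "\<And>p q. sgn_equal L' p q \<Longrightarrow> sgn_match (snd ` set_mset M') p q" by blast
    define J where "J = {i \<in> set_mset M. fst i \<ge> 1}"
    \<comment> \<open>The signs of the top coefficients put \<open>p\<close> and \<open>q\<close>
      into the same case: some coefficient of positive index vanishes at both, covered by
      \<open>Lt\<close>, or none does, covered by \<open>L'\<close>.\<close>
    define L where "L = lc ` set_mset M \<union> (\<Union>i\<in>J. Lt i) \<union> L'"
    have "finite J" "\<And>i. i \<in> J \<Longrightarrow> finite (Lt i) \<and> Lt i \<subseteq> F"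
      using Lt by (simp_all add: J_def)
    then have "finite L" "L \<subseteq> F" using L'(1,2) lcF by (auto simp: L_def)
    moreover have "sgn_match (snd ` set_mset M) p q" if "sgn_equal L p q" for p q
    proof -
      have eq: "sgn_equal (lc ` set_mset M) p q" "\<And>i. i \<in> J \<Longrightarrow> sgn_equal (Lt i) p q"
        "sgn_equal L' p q"
        using that by (auto simp: L_def sgn_equal_Un sgn_equal_UN)
      have slc: "sgn (coeff (g p) k) = sgn (coeff (g q) k)" if "(k, g) \<in># M" for k g
        using eq(1) that by (force simp: sgn_equal_def lc_def)
      show ?thesis
      proof (cases "\<exists>(k, g)\<in>#M. k \<ge> 1 \<and> coeff (g p) k = 0")
        case True
        then obtain k g where i: "(k, g) \<in># M" "k \<ge> 1" "coeff (g p) k = 0" by blast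
        have "coeff (g q) k = 0" using slc[OF i(1)] i(3) by (simp add: sgn_0_0)
        then have tr: "truncate k g p = g p" "truncate k g q = g q"
          using i(3) by (simp_all add: truncate_def)
        have "sgn_match (snd ` set_mset (trunc (k, g))) p q"
          using Lt[of "(k, g)"] eq(2)[of "(k, g)"] i by (simp add: J_def)
        then obtain h where h: "strict_mono h" "surj h"
          and m: "\<And>P t. P \<in> snd ` set_mset (trunc (k, g)) \<Longrightarrow> sgn (poly (P p) t) = sgn (poly (P q) (h t))"
          unfolding sgn_match_def by blast
        have "sgn (poly (P p) t) = sgn (poly (P q) (h t))" if P: "P \<in> snd ` set_mset M" for P t
        proof (cases "P = g")
          case True
          have "truncate k g \<in> snd ` set_mset (trunc (k, g))" by (simp add: trunc_def)
          from m[OF this, of t] show ?thesis using True tr by simp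
        next
          case False
          obtain j where j: "(j, P) \<in># M" using P by auto
          then have "(j, P) \<in># M - {#(k, g)#}" using False by (simp add: in_diff_count)
          then have "P \<in> snd ` set_mset (trunc (k, g))" by (force simp: trunc_def)
          then show ?thesis using m by blast
        qed
        then show ?thesis unfolding sgn_match_def using h by blast
      next
        case False
        have lf: "coeff (f p) n \<noteq> 0" using False f n1 by blast
        have "sgn_match (insert f (snd ` set_mset N)) p q"
        proof (rule sgn_match_add_poly[OF PP[OF f] n1 finite_set_mset lf])
          show "(n - 1, \<lambda>p. pderiv (f p)) \<in># N" by (simp add: N_def)
          show "coeff (g p) k \<noteq> 0" if "(k, g) \<in># N" "k \<ge> 1" for k g
            using that False lf n1 unfolding N_def M by (auto simp: coeff_pderiv)
          show "sgn (coeff (g p) k) = sgn (coeff (g q) k)" if "(k, g) \<in># N" for k g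
            using that slc[of k g] slc[OF f] n1 unfolding N_def M
            by (auto simp: coeff_pderiv sgn_mult)
          have "snd ` set_mset M' = snd ` set_mset N \<union> (\<lambda>(k, g). reduce n f k g) ` set_mset N"
            by (simp add: M'_def image_Un image_image case_prod_beta)
          then show "sgn_match (snd ` set_mset N \<union> (\<lambda>(k, g). reduce n f k g) ` set_mset N) p q"
            using L'(3)[OF eq(3)] by simp
        qed (use N_PP in auto)
        then show ?thesis unfolding sgn_match_def by (auto simp: M N_def)
      qed
    qed
    ultimately show ?thesis by blast
  qed
qed

section \<open>Definable predicates\<close>

text \<open>A semantic form of quantifier-free formulas: finitely many functions have finitely many
  sign patterns, so such a predicate is a Boolean combination of sign conditions.\<close>

definition definable :: "('p \<Rightarrow> bool) \<Rightarrow> bool" where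
  "definable \<phi> \<longleftrightarrow> (\<exists>L. finite L \<and> L \<subseteq> F \<and> (\<forall>p q. sgn_equal L p q \<longrightarrow> \<phi> p = \<phi> q))"

lemma definable_atom: "f \<in> F \<Longrightarrow> definable (\<lambda>p. R (sgn (f p)))"
  unfolding definable_def by (intro exI[of _ "{f}"]) (auto simp: sgn_equal_def)

lemma definable_const: "definable (\<lambda>p. b)"
  unfolding definable_def by blast

lemma definable_ge: "f \<in> F \<Longrightarrow> definable (\<lambda>p. f p \<ge> 0)"
  using definable_atom[of f "\<lambda>s. s \<ge> 0"] by simp

lemma definable_gt: "f \<in> F \<Longrightarrow> definable (\<lambda>p. f p > 0)"
  using definable_atom[of f "\<lambda>s. s > 0"] by simp

lemma definable_conj: "definable \<phi> \<Longrightarrow> definable \<psi> \<Longrightarrow> definable (\<lambda>p. \<phi> p \<and> \<psi> p)"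
  unfolding definable_def by (elim exE) (metis finite_Un le_sup_iff sgn_equal_Un)

lemma definable_not: "definable \<phi> \<Longrightarrow> definable (\<lambda>p. \<not> \<phi> p)"
  unfolding definable_def by blast

lemma definable_ball:
  "finite I \<Longrightarrow> (\<And>i. i \<in> I \<Longrightarrow> definable (\<phi> i)) \<Longrightarrow> definable (\<lambda>p. \<forall>i\<in>I. \<phi> i p)"
  by (induction I rule: finite_induct) (auto intro: definable_const definable_conj)

lemma definable_bex:
  "finite I \<Longrightarrow> (\<And>i. i \<in> I \<Longrightarrow> definable (\<phi> i)) \<Longrightarrow> definable (\<lambda>p. \<exists>i\<in>I. \<phi> i p)"
  using definable_not[OF definable_ball[of I "\<lambda>i p. \<not> \<phi> i p"]] definable_not by simp

end

section \<open>Quantifiers over one coordinate\<close>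

text \<open>Parameters pair a function on the coefficient ring with a real sequence. The values
  \<open>fst p a\<close> count as independent quantities during elimination.\<close>

inductive_set coord_alg :: "(('a \<Rightarrow> real) \<times> (nat \<Rightarrow> real) \<Rightarrow> real) set" where
  const: "(\<lambda>p. c) \<in> coord_alg"
| coeff: "(\<lambda>p. fst p a) \<in> coord_alg"
| var: "(\<lambda>p. snd p i) \<in> coord_alg"
| add: "f \<in> coord_alg \<Longrightarrow> g \<in> coord_alg \<Longrightarrow> (\<lambda>p. f p + g p) \<in> coord_alg"
| mult: "f \<in> coord_alg \<Longrightarrow> g \<in> coord_alg \<Longrightarrow> (\<lambda>p. f p * g p) \<in> coord_alg"

interpretation coord: fun_algebra coord_alg
  by standard (auto intro: coord_alg.intros)

definition upd :: "nat \<Rightarrow> real \<Rightarrow> ('a \<Rightarrow> real) \<times> (nat \<Rightarrow> real) \<Rightarrow> ('a \<Rightarrow> real) \<times> (nat \<Rightarrow> real)" where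
  "upd i t p = (fst p, (snd p)(i := t))"

lemma fst_upd [simp]: "fst (upd i t p) = fst p"
  and snd_upd [simp]: "snd (upd i t p) = (snd p)(i := t)"
  by (simp_all add: upd_def)

text \<open>Induction on \<open>f\<close> collects coordinate \<open>i\<close> as the variable of a
  polynomial with coefficients in \<open>coord_alg\<close>, the form to which
  \<open>sgn_match_determined\<close> applies.\<close>

lemma coord_alg_upd:
  assumes "f \<in> coord_alg"
  shows "\<exists>n P. coord.param_poly n P \<and> (\<forall>p t. f (upd i t p) = poly (P p) t)"
  using assms
proof induction
  case (const c)
  show ?case
    by (intro exI[of _ 0] exI[of _ "\<lambda>p. [:c:]"] conjI coord.param_poly_const coord_alg.const) simp
next
  case (coeff a)
  show ?case
    by (intro exI[of _ 0] exI[of _ "\<lambda>p. [:fst p a:]"] conjI coord.param_poly_const coord_alg.coeff) simp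
next
  case (var j)
  show ?case
  proof (cases "j = i")
    case True
    then show ?thesis
      by (intro exI[of _ 1] exI[of _ "\<lambda>p. monom 1 1"] conjI coord.param_poly_monom coord_alg.const)
        (simp add: poly_monom)
  next
    case False
    then show ?thesis
      by (intro exI[of _ 0] exI[of _ "\<lambda>p. [:snd p j:]"] conjI coord.param_poly_const coord_alg.var) simp
  qed
next
  case (add f g)
  then obtain n P m Q where "coord.param_poly n P" "coord.param_poly m Q"
    and *: "\<forall>p t. f (upd i t p) = poly (P p) t" "\<forall>p t. g (upd i t p) = poly (Q p) t" by blast
  then have "coord.param_poly (max n m) (\<lambda>p. P p + Q p)"
    by (intro coord.param_poly_add) (auto intro: coord.param_poly_mono)
  then show ?case using * by (metis poly_add)
next
  case (mult f g)
  then obtain n P m Q where "coord.param_poly n P" "coord.param_poly m Q"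
    and *: "\<forall>p t. f (upd i t p) = poly (P p) t" "\<forall>p t. g (upd i t p) = poly (Q p) t" by blast
  then have "coord.param_poly (n + m) (\<lambda>p. P p * Q p)"
    by (intro coord.param_poly_mult)
  then show ?case using * by (metis poly_mult)
qed

text \<open>
  The condition \<open>h (snd p N) = snd q N\<close>, obtained by including \<open>t - snd p N\<close> among the polynomials to be
  matched, makes \<open>h\<close> transport limits at the point \<open>snd p N\<close>.
\<close>

lemma definable_fibres:
  assumes "coord.definable \<phi>"
  shows "\<exists>L. finite L \<and> L \<subseteq> coord_alg \<and> (\<forall>p q. coord.sgn_equal L p q \<longrightarrow>
    (\<exists>h. strict_mono h \<and> surj h \<and> h (snd p N) = snd q N \<and>
         (\<forall>t. \<phi> (upd i t p) \<longleftrightarrow> \<phi> (upd i (h t) q))))"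
proof -
  obtain L0 where L0: "finite L0" "L0 \<subseteq> coord_alg"
    and \<phi>: "\<And>p q. coord.sgn_equal L0 p q \<Longrightarrow> \<phi> p = \<phi> q"
    using assms unfolding coord.definable_def by blast
  have "\<forall>a\<in>L0. \<exists>n P. coord.param_poly n P \<and> (\<forall>p t. a (upd i t p) = poly (P p) t)"
    using coord_alg_upd L0(2) by blast
  then obtain n P where P: "\<And>a. a \<in> L0 \<Longrightarrow> coord.param_poly (n a) (P a)"
    and aP: "\<And>a p t. a \<in> L0 \<Longrightarrow> a (upd i t p) = poly (P a p) t"
    by metis
  define D where "D = (\<lambda>p :: ('a \<Rightarrow> real) \<times> (nat \<Rightarrow> real). monom 1 1 - [:snd p N:])"
  have D: "coord.param_poly 1 D" unfolding D_def
    by (intro coord.param_poly_diff coord.param_poly_monom coord_alg.const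
        coord.param_poly_mono[OF coord.param_poly_const] coord_alg.var) simp
  have poly_D: "poly (D p) t = t - snd p N" for p t by (simp add: D_def poly_monom)
  define M where "M = add_mset (1, D) (image_mset (\<lambda>a. (n a, P a)) (mset_set L0))"
  have "coord.param_poly k g" if "(k, g) \<in># M" for k g
    using that D P L0(1) by (auto simp: M_def)
  then obtain L where L: "finite L" "L \<subseteq> coord_alg"
    and match: "\<And>p q. coord.sgn_equal L p q \<Longrightarrow> coord.sgn_match (snd ` set_mset M) p q"
    using coord.sgn_match_determined[of M] by blast
  have "\<exists>h. strict_mono h \<and> surj h \<and> h (snd p N) = snd q N \<and>
         (\<forall>t. \<phi> (upd i t p) \<longleftrightarrow> \<phi> (upd i (h t) q))" if eq: "coord.sgn_equal L p q" for p q
  proof -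
    have sM: "snd ` set_mset M = insert D (P ` L0)"
      using L0(1) by (simp add: M_def image_image)
    obtain h where h: "strict_mono h" "surj h"
      and m: "\<forall>R\<in>insert D (P ` L0). \<forall>t. sgn (poly (R p) t) = sgn (poly (R q) (h t))"
      using match[OF eq] unfolding coord.sgn_match_def sM by blast
    have "sgn (h (snd p N) - snd q N) = 0"
      using m by (simp add: poly_D) (metis diff_self sgn_0)
    then have "h (snd p N) = snd q N" by (simp add: sgn_0_0)
    moreover have "\<phi> (upd i t p) \<longleftrightarrow> \<phi> (upd i (h t) q)" for t
      using m by (intro \<phi>) (simp add: coord.sgn_equal_def aP)
    ultimately show ?thesis using h by blast
  qed
  then show ?thesis using L by blast
qed

text \<open>The increasing map between the two fibres is onto, so witnesses travel in both
  directions. The index 0 given for the limit coordinate is arbitrary.\<close>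

lemma definable_ex:
  assumes "coord.definable \<phi>"
  shows "coord.definable (\<lambda>p. \<exists>t. \<phi> (upd i t p))"
proof -
  obtain L where L: "finite L" "L \<subseteq> coord_alg" and
    h: "\<And>p q. coord.sgn_equal L p q \<Longrightarrow> \<exists>h. strict_mono h \<and> surj h \<and> h (snd p 0) = snd q 0 \<and>
         (\<forall>t. \<phi> (upd i t p) \<longleftrightarrow> \<phi> (upd i (h t) q))"
    using definable_fibres[OF assms, of 0 i] by blast
  have "(\<exists>t. \<phi> (upd i t p)) \<longleftrightarrow> (\<exists>t. \<phi> (upd i t q))" if "coord.sgn_equal L p q" for p q
    using h[OF that] by (metis surjD)
  then show ?thesis unfolding coord.definable_def using L by blast
qed

text \<open>
  The constant functions stand for limits at infinity; there the point \<open>c\<close> is irrelevant.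
\<close>

definition limit_types :: "(real \<Rightarrow> real filter) set" where
  "limit_types = {\<lambda>c. principal {c}, at_right, at_left, \<lambda>c. at_top, \<lambda>c. at_bot}"

lemma finite_limit_types: "finite limit_types"
  by (simp add: limit_types_def)

lemma limit_type_neq_bot: "K \<in> limit_types \<Longrightarrow> K c \<noteq> bot"
  by (auto simp: limit_types_def principal_eq_bot_iff)

text \<open>An increasing bijection maps the sets that generate the filter at \<open>c\<close> onto
  those at \<open>h c\<close>, so all quantifiers can be reindexed by \<open>h\<close>.\<close>

lemma eventually_limit_type_transfer:
  assumes K: "K \<in> limit_types" and h: "strict_mono h" "surj h"
  shows "eventually \<phi> (K (h c)) \<longleftrightarrow> eventually (\<lambda>t. \<phi> (h t)) (K c)"
proof -
  have lt: "h x < h y \<longleftrightarrow> x < y" and le: "h x \<le> h y \<longleftrightarrow> x \<le> y" for x y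
    using h(1) by (simp_all add: strict_mono_less strict_mono_less_eq)
  have all: "(\<forall>s. R s) \<longleftrightarrow> (\<forall>t. R (h t))" and ex: "(\<exists>s. R s) \<longleftrightarrow> (\<exists>t. R (h t))" for R
    using h(2) by (metis surjD)+
  consider "K = (\<lambda>c. principal {c})" | "K = at_right" | "K = at_left" | "K = (\<lambda>c. at_top)" | "K = (\<lambda>c. at_bot)"
    using K by (auto simp: limit_types_def)
  then show ?thesis
  proof cases
    case 1
    then show ?thesis by (simp add: eventually_principal)
  next
    case 2
    then show ?thesis
      by (simp add: eventually_at_right_field ex[of "\<lambda>b. b > h c \<and> (\<forall>y>h c. y < b \<longrightarrow> \<phi> y)"] all[of "\<lambda>y. y > h c \<longrightarrow> y < h _ \<longrightarrow> \<phi> y"] lt)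
  next
    case 3
    then show ?thesis
      by (simp add: eventually_at_left_field ex[of "\<lambda>b. b < h c \<and> (\<forall>y>b. y < h c \<longrightarrow> \<phi> y)"] all[of "\<lambda>y. y > h _ \<longrightarrow> y < h c \<longrightarrow> \<phi> y"] lt)
  next
    case 4
    then show ?thesis
      by (simp add: eventually_at_top_linorder ex[of "\<lambda>b. \<forall>y\<ge>b. \<phi> y"] all[of "\<lambda>y. h _ \<le> y \<longrightarrow> \<phi> y"] le)
  next
    case 5
    then show ?thesis
      by (simp add: eventually_at_bot_linorder ex[of "\<lambda>b. \<forall>y\<le>b. \<phi> y"] all[of "\<lambda>y. y \<le> h _ \<longrightarrow> \<phi> y"] le)
  qed
qed

section \<open>Limit types decide definable predicates\<close>

lemma limit_type_sgn:
  assumes "K \<in> limit_types"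
  shows "\<exists>\<sigma>. eventually (\<lambda>t. sgn (t - z) = \<sigma>) (K c)"
proof -
  have gt: ?thesis if "eventually (\<lambda>t. z < t) (K c)"
    using that by (intro exI[of _ 1]) (auto elim: eventually_mono)
  have lt: ?thesis if "eventually (\<lambda>t. t < z) (K c)"
    using that by (intro exI[of _ "-1"]) (auto elim: eventually_mono)
  consider "K = (\<lambda>c. principal {c})" | "K = at_right" | "K = at_left" | "K = (\<lambda>c. at_top)" | "K = (\<lambda>c. at_bot)"
    using assms by (auto simp: limit_types_def)
  then show ?thesis
  proof cases
    case 1
    then show ?thesis by (simp add: eventually_principal)
  next
    case 2
    show ?thesis
    proof (cases "z \<le> c")
      case True
      then have "eventually (\<lambda>t. z < t) (at_right c)"
        by (intro eventually_mono[OF eventually_at_right_less]) auto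
      then show ?thesis using gt 2 by simp
    next
      case False
      then have "eventually (\<lambda>t. t < z) (at_right c)"
        by (intro order_tendstoD[OF tendsto_ident_at]) auto
      then show ?thesis using lt 2 by simp
    qed
  next
    case 3
    show ?thesis
    proof (cases "c \<le> z")
      case True
      have "eventually (\<lambda>t. t < c) (at_left c)" by (simp add: eventually_at_filter)
      then have "eventually (\<lambda>t. t < z) (at_left c)"
        by (rule eventually_mono) (use True in auto)
      then show ?thesis using lt 3 by simp
    next
      case False
      then have "eventually (\<lambda>t. z < t) (at_left c)"
        by (intro order_tendstoD[OF tendsto_ident_at]) auto
      then show ?thesis using gt 3 by simp
    qed
  next
    case 4
    then show ?thesis using gt eventually_gt_at_top by blast
  next
    case 5
    then show ?thesis using lt eventually_gt_at_bot by blast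
  qed
qed

text \<open>The position relative to each of the finitely many roots is eventually fixed, so
  \<open>t\<close> stays in one cell, where the sign is constant.\<close>

lemma limit_type_sgn_poly:
  fixes f :: "real poly"
  assumes K: "K \<in> limit_types"
  shows "\<exists>\<sigma>. eventually (\<lambda>t. sgn (poly f t) = \<sigma>) (K c)"
proof (cases "f = 0")
  case True
  then show ?thesis by (intro exI[of _ 0]) simp
next
  case False
  define Z where "Z = {t. poly f t = 0}"
  have Z: "finite Z" using False by (simp add: Z_def poly_roots_finite)
  have "\<forall>z. \<exists>\<sigma>. eventually (\<lambda>t. sgn (t - z) = \<sigma>) (K c)"
    using limit_type_sgn[OF K] by blast
  then obtain \<tau> where \<tau>: "\<forall>z. eventually (\<lambda>t. sgn (t - z) = \<tau> z) (K c)"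
    by (auto dest: choice)
  then have ev: "eventually (\<lambda>t. \<forall>z\<in>Z. sgn (t - z) = \<tau> z) (K c)"
    by (intro eventually_ball_finite Z) blast
  then obtain t0 where t0: "\<forall>z\<in>Z. sgn (t0 - z) = \<tau> z"
    using eventually_happens'[OF limit_type_neq_bot[OF K]] by blast
  have "eventually (\<lambda>t. sgn (poly f t) = sgn (poly f t0)) (K c)"
    using ev
  proof (rule eventually_mono)
    fix t assume t: "\<forall>z\<in>Z. sgn (t - z) = \<tau> z"
    have "t \<in> cell Z t0" unfolding cell_def
    proof (intro CollectI ballI)
      fix z assume "z \<in> Z"
      then have "sgn (t - z) = sgn (t0 - z)" using t t0 by simp
      then have "0 < t0 - z \<longleftrightarrow> 0 < t - z" "t0 - z < 0 \<longleftrightarrow> t - z < 0"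
        by (metis sgn_greater sgn_less)+
      then show "(z < t0 \<longleftrightarrow> z < t) \<and> (t0 < z \<longleftrightarrow> t < z)" by simp
    qed
    then show "sgn (poly f t) = sgn (poly f t0)"
      by (intro sgn_poly_cell[of f Z]) (auto simp: Z_def)
  qed
  then show ?thesis by blast
qed

text \<open>The signs of finitely many polynomials in \<open>t\<close> decide the predicate, and
  each is eventually constant. Limit types thus act as ultrafilters on definable predicates.\<close>

lemma definable_decided:
  assumes "coord.definable \<phi>" and K: "K \<in> limit_types"
  shows "eventually (\<lambda>t. \<phi> (upd i t p)) (K c) \<or> eventually (\<lambda>t. \<not> \<phi> (upd i t p)) (K c)"
proof -
  obtain L0 where L0: "finite L0" "L0 \<subseteq> coord_alg"
    and \<phi>: "\<And>p q. coord.sgn_equal L0 p q \<Longrightarrow> \<phi> p = \<phi> q"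
    using assms unfolding coord.definable_def by blast
  have "\<forall>a\<in>L0. \<exists>\<sigma>. eventually (\<lambda>t. sgn (a (upd i t p)) = \<sigma>) (K c)"
  proof
    fix a assume "a \<in> L0"
    then obtain P where "\<forall>p t. a (upd i t p) = poly (P p) t"
      using coord_alg_upd L0(2) by blast
    then show "\<exists>\<sigma>. eventually (\<lambda>t. sgn (a (upd i t p)) = \<sigma>) (K c)"
      using limit_type_sgn_poly[OF K, of "P p"] by (simp del: split_paired_All)
  qed
  then obtain \<sigma> where "\<And>a. a \<in> L0 \<Longrightarrow> eventually (\<lambda>t. sgn (a (upd i t p)) = \<sigma> a) (K c)"
    by metis
  then have ev: "eventually (\<lambda>t. \<forall>a\<in>L0. sgn (a (upd i t p)) = \<sigma> a) (K c)"
    by (intro eventually_ball_finite L0) blast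
  then obtain t0 where t0: "\<forall>a\<in>L0. sgn (a (upd i t0 p)) = \<sigma> a"
    using eventually_happens'[OF limit_type_neq_bot[OF K]] by blast
  have "eventually (\<lambda>t. \<phi> (upd i t p) = \<phi> (upd i t0 p)) (K c)"
    using ev by (rule eventually_mono) (use t0 in \<open>auto intro!: \<phi> simp: coord.sgn_equal_def\<close>)
  then show ?thesis by (cases "\<phi> (upd i t0 p)") (auto elim: eventually_mono)
qed

text \<open>The limit point is stored in coordinate \<open>N\<close>, so that it is a parameter and
  can be quantified later. The map between the fibres sends one limit point to the other and
  transports the filter.\<close>

lemma definable_eventually:
  assumes "coord.definable \<phi>" and K: "K \<in> limit_types"
  shows "coord.definable (\<lambda>p. eventually (\<lambda>t. \<phi> (upd i t p)) (K (snd p N)))"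
proof -
  obtain L where L: "finite L" "L \<subseteq> coord_alg" and
    h: "\<And>p q. coord.sgn_equal L p q \<Longrightarrow> \<exists>h. strict_mono h \<and> surj h \<and> h (snd p N) = snd q N \<and>
         (\<forall>t. \<phi> (upd i t p) \<longleftrightarrow> \<phi> (upd i (h t) q))"
    using definable_fibres[OF assms(1), of N i] by blast
  have "eventually (\<lambda>t. \<phi> (upd i t p)) (K (snd p N)) \<longleftrightarrow> eventually (\<lambda>t. \<phi> (upd i t q)) (K (snd q N))"
    if "coord.sgn_equal L p q" for p q
  proof -
    obtain h where "strict_mono h" "surj h" and hN: "h (snd p N) = snd q N"
      and *: "\<forall>t. \<phi> (upd i t p) \<longleftrightarrow> \<phi> (upd i (h t) q)"
      using h[OF \<open>coord.sgn_equal L p q\<close>] by blast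
    then show ?thesis
      using eventually_limit_type_transfer[OF K, of h "\<lambda>t. \<phi> (upd i t q)" "snd p N"] by simp
  qed
  then show ?thesis unfolding coord.definable_def using L by blast
qed

section \<open>Sequences and iterated limits\<close>

text \<open>A bounded sequence either reaches its limit and stays there or converges strictly from
  below; an unbounded one tends to \<infinity>.\<close>

lemma limit_type_incseq:
  fixes y :: "nat \<Rightarrow> real"
  assumes y: "incseq y"
  shows "\<exists>K\<in>limit_types. \<exists>c. filterlim y (K c) sequentially"
proof (cases "\<exists>B. \<forall>n. y n \<le> B")
  case True
  then obtain L where L: "y \<longlonglongrightarrow> L" "\<And>n. y n \<le> L" using incseq_convergent[OF y] by metis
  show ?thesis
  proof (cases "\<exists>n. y n = L")
    case True
    then obtain n where "y n = L" by blast
    then have "\<forall>m\<ge>n. y m = L" using L(2) y by (metis incseq_def order_antisym)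
    then have "filterlim y (principal {L}) sequentially"
      by (auto simp: filterlim_principal eventually_sequentially)
    then show ?thesis by (intro bexI[of _ "\<lambda>c. principal {c}"] exI[of _ L]) (auto simp: limit_types_def)
  next
    case False
    then have "y n < L" for n using L(2)[of n] by (metis order_le_imp_less_or_eq)
    then have "filterlim y (at_left L) sequentially"
      using L(1) by (auto simp: filterlim_at less_imp_neq)
    then show ?thesis by (intro bexI[of _ at_left] exI[of _ L]) (auto simp: limit_types_def)
  qed
next
  case False
  have "eventually (\<lambda>n. B \<le> y n) sequentially" for B
  proof -
    obtain n where "B < y n" using False by (metis not_le)
    then have "\<forall>m\<ge>n. B \<le> y m" using y by (meson incseq_def less_imp_le order_trans)
    then show ?thesis by (auto simp: eventually_sequentially)
  qed
  then have "filterlim y at_top sequentially" by (simp add: filterlim_at_top)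
  then show ?thesis by (intro bexI[of _ "\<lambda>c. at_top"]) (auto simp: limit_types_def)
qed

text \<open>Reduces decreasing sequences to increasing ones.\<close>

lemma limit_type_uminus:
  assumes "K \<in> limit_types"
  shows "\<exists>K'\<in>limit_types. filterlim uminus (K' (- c)) (K c)"
proof -
  consider "K = (\<lambda>c. principal {c})" | "K = at_right" | "K = at_left" | "K = (\<lambda>c. at_top)" | "K = (\<lambda>c. at_bot)"
    using assms by (auto simp: limit_types_def)
  then show ?thesis
  proof cases
    case 1
    then show ?thesis
      by (intro bexI[of _ "\<lambda>c. principal {c}"]) (auto simp: limit_types_def filterlim_principal eventually_principal)
  next
    case 2
    have "filterlim uminus (at_left (- c)) (at_right c)"
      by (auto simp: filterlim_at eventually_at_filter intro!: tendsto_minus tendsto_ident_at)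
    then show ?thesis using 2 by (intro bexI[of _ at_left]) (auto simp: limit_types_def)
  next
    case 3
    have "filterlim uminus (at_right (- c)) (at_left c)"
      by (auto simp: filterlim_at eventually_at_filter intro!: tendsto_minus tendsto_ident_at)
    then show ?thesis using 3 by (intro bexI[of _ at_right]) (auto simp: limit_types_def)
  next
    case 4
    then show ?thesis using filterlim_uminus_at_bot_at_top
      by (intro bexI[of _ "\<lambda>c. at_bot"]) (auto simp: limit_types_def)
  next
    case 5
    then show ?thesis using filterlim_uminus_at_top_at_bot
      by (intro bexI[of _ "\<lambda>c. at_top"]) (auto simp: limit_types_def)
  qed
qed

lemma limit_type_subseq:
  fixes x :: "nat \<Rightarrow> real"
  obtains r K c where "strict_mono r" "K \<in> limit_types" "filterlim (x \<circ> r) (K c) sequentially"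
proof -
  obtain r where r: "strict_mono r" "monoseq (\<lambda>n. x (r n))"
    using seq_monosub by blast
  have "\<exists>K\<in>limit_types. \<exists>c. filterlim (x \<circ> r) (K c) sequentially"
  proof (cases "incseq (x \<circ> r)")
    case True
    then show ?thesis by (rule limit_type_incseq)
  next
    case False
    then have "incseq (\<lambda>n. - (x \<circ> r) n)"
      using r(2) by (auto simp: monoseq_def incseq_def)
    then obtain K c where K: "K \<in> limit_types" "filterlim (\<lambda>n. - (x \<circ> r) n) (K c) sequentially"
      using limit_type_incseq by blast
    obtain K' where "K' \<in> limit_types" "filterlim uminus (K' (- c)) (K c)"
      using limit_type_uminus[OF K(1)] by blast
    then have "filterlim (x \<circ> r) (K' (- c)) sequentially"
      using filterlim_compose[OF _ K(2), of uminus] by (simp add: comp_def)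
    then show ?thesis using \<open>K' \<in> limit_types\<close> by blast
  qed
  then show thesis using that r(1) by blast
qed

section \<open>Iterated limits along a filter\<close>

text \<open>\<open>ts\<close> lists the values already chosen, \<open>r\<close> counts the
  quantifiers still to come. The order matters, since quantifiers along a filter need not
  commute.\<close>

primrec iter_eventually :: "real filter \<Rightarrow> (real list \<Rightarrow> bool) \<Rightarrow> nat \<Rightarrow> real list \<Rightarrow> bool" where
  "iter_eventually \<F> G 0 ts = G ts"
| "iter_eventually \<F> G (Suc r) ts = eventually (\<lambda>t. iter_eventually \<F> G r (ts @ [t])) \<F>"

text \<open>If a quantifier failed, \<open>decided\<close> would make its negation hold at
  \<open>y n\<close> for some \<open>n\<close> beyond the indices used; but appending
  \<open>n\<close> keeps them increasing, against the induction hypothesis.\<close>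

lemma iter_eventually_of_seq:
  assumes y: "filterlim y \<F> sequentially"
    and G: "\<And>js. sorted_wrt (<) js \<Longrightarrow> length js = m \<Longrightarrow> G (map y js)"
    and decided: "\<And>r ts. Suc r + length ts = m \<Longrightarrow>
      eventually (\<lambda>t. iter_eventually \<F> G r (ts @ [t])) \<F> \<or>
      eventually (\<lambda>t. \<not> iter_eventually \<F> G r (ts @ [t])) \<F>"
  shows "sorted_wrt (<) js \<Longrightarrow> r + length js = m \<Longrightarrow> iter_eventually \<F> G r (map y js)"
proof (induction r arbitrary: js)
  case 0
  then show ?case using G by simp
next
  case (Suc r)
  show ?case
  proof (rule ccontr)
    assume "\<not> ?thesis"
    then have "eventually (\<lambda>t. \<not> iter_eventually \<F> G r (map y js @ [t])) \<F>"
      using decided[of r "map y js"] Suc.prems(2) by simp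
    then have "eventually (\<lambda>n. \<not> iter_eventually \<F> G r (map y js @ [y n])) sequentially"
      using y by (rule eventually_compose_filterlim)
    moreover have "eventually (\<lambda>n. \<forall>j\<in>set js. j < n) sequentially"
      by (intro eventually_ball_finite) (auto intro: eventually_gt_at_top)
    ultimately have "eventually (\<lambda>n. \<not> iter_eventually \<F> G r (map y js @ [y n]) \<and> (\<forall>j\<in>set js. j < n)) sequentially"
      by (rule eventually_conj)
    then obtain n where n: "\<not> iter_eventually \<F> G r (map y js @ [y n])" "\<forall>j\<in>set js. j < n"
      using eventually_happens'[OF sequentially_bot] by blast
    have "iter_eventually \<F> G r (map y (js @ [n]))"
      using Suc n(2) by (intro Suc.IH) (auto simp: sorted_wrt_append)
    then show False using n(1) by simp
  qed
qed

text \<open>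
  The sequence is chosen term by term so that every subsequence \<open>ts\<close> of an initial segment can be
  completed: the remaining \<open>m - length ts\<close> quantifiers hold after \<open>ts\<close>.
\<close>

lemma seq_of_iter_eventually:
  assumes \<F>: "\<F> \<noteq> bot" and G: "iter_eventually \<F> G m []"
  shows "\<exists>y :: nat \<Rightarrow> real. \<forall>js. sorted_wrt (<) js \<longrightarrow> length js = m \<longrightarrow> G (map y js)"
proof -
  define good where "good ys \<longleftrightarrow> (\<forall>ts. subseq ts ys \<longrightarrow> length ts \<le> m \<longrightarrow>
    iter_eventually \<F> G (m - length ts) ts)" for ys
  have step: "\<exists>t. good (ys @ [t])" if ys: "good ys" for ys
  proof -
    define S where "S = {ts \<in> set (subseqs ys). length ts < m}"
    have "eventually (\<lambda>t. \<forall>ts\<in>S. iter_eventually \<F> G (m - Suc (length ts)) (ts @ [t])) \<F>"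
    proof (rule eventually_ball_finite)
      show "\<forall>ts\<in>S. eventually (\<lambda>t. iter_eventually \<F> G (m - Suc (length ts)) (ts @ [t])) \<F>"
      proof
        fix ts assume "ts \<in> S"
        then have "length ts < m" "iter_eventually \<F> G (m - length ts) ts"
          using ys by (auto simp: S_def good_def)
        moreover from this have "m - length ts = Suc (m - Suc (length ts))" by simp
        ultimately show "eventually (\<lambda>t. iter_eventually \<F> G (m - Suc (length ts)) (ts @ [t])) \<F>"
          by simp
      qed
    qed (simp add: S_def del: in_set_subseqs)
    then obtain t where t: "\<forall>ts\<in>S. iter_eventually \<F> G (m - Suc (length ts)) (ts @ [t])"
      using eventually_happens'[OF \<F>] by blast
    have "good (ys @ [t])" unfolding good_def
    proof (intro allI impI)
      fix us assume us: "subseq us (ys @ [t])" "length us \<le> m"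
      then obtain vs ws where v: "us = vs @ ws" "subseq vs ys" "subseq ws [t]"
        by (auto simp: subseq_append_iff)
      then have "ws = [] \<or> ws = [t]" by (cases ws) (auto split: if_splits dest: list_emb_Nil2)
      then show "iter_eventually \<F> G (m - length us) us"
        using v us(2) ys t by (auto simp: good_def S_def)
    qed
    then show ?thesis by blast
  qed
  define ys where "ys = rec_nat [] (\<lambda>_ zs. zs @ [SOME t. good (zs @ [t])])"
  define y where "y n = (SOME t. good (ys n @ [t]))" for n
  have ys_Suc: "ys (Suc n) = ys n @ [y n]" for n by (simp add: ys_def y_def)
  have good_ys: "good (ys n)" for n
  proof (induction n)
    case 0
    then show ?case using G by (auto simp: ys_def good_def dest: list_emb_Nil2)
  next
    case (Suc n)
    then show ?case using someI_ex[OF step] by (simp add: ys_Suc y_def)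
  qed
  have ys_map: "ys n = map y [0..<n]" for n
  proof (induction n)
    case 0
    show ?case by (simp add: ys_def)
  next
    case (Suc n)
    then show ?case by (simp add: ys_Suc)
  qed
  have "G (map y js)" if js: "sorted_wrt (<) js" "length js = m" for js
  proof -
    \<comment> \<open>Increasing indices form a subsequence of an initial segment of the naturals,
      so their values form one of some \<open>ys n\<close>.\<close>
    obtain n where "\<forall>j\<in>set js. j < n" using finite_nat_set_iff_bounded by blast
    then have "subseq js [0..<n]"
      using js(1) by (intro sorted_subset_imp_subseq) auto
    then have "subseq (map y js) (ys n)" unfolding ys_map by (rule subseq_map)
    then show ?thesis using good_ys[of n] js(2) by (force simp: good_def)
  qed
  then show ?thesis by (intro exI[of _ y]) simp
qed

text \<open>Chosen values occupy the first coordinates and each quantifier binds the next one. The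
  limit point sits at \<open>N\<close>, beyond all of them, so it is never overwritten.\<close>

lemma definable_iter_eventually:
  assumes K: "K \<in> limit_types" and N: "m \<le> N"
    and G: "coord.definable (\<lambda>p. G (fst p) (map (snd p) [0..<m]))"
  shows "r \<le> m \<Longrightarrow>
    coord.definable (\<lambda>p. iter_eventually (K (snd p N)) (G (fst p)) r (map (snd p) [0..<m - r]))"
proof (induction r)
  case 0
  then show ?case using G by simp
next
  case (Suc r)
  define i where "i = m - Suc r"
  have i: "m - r = Suc i" "i \<noteq> N" using Suc.prems N by (auto simp: i_def)
  have "map (\<lambda>j. if j = i then t else snd p j) [0..<Suc i] = map (snd p) [0..<i] @ [t]"
    for p :: "('a \<Rightarrow> real) \<times> (nat \<Rightarrow> real)" and t by simp
  then show ?case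
    using definable_eventually[OF Suc.IH K, of i N] Suc.prems i
    by (simp flip: i_def del: upt_Suc map_fun_upd)
qed

section \<open>Real points and semialgebraic sets\<close>

text \<open>Setting a coefficient outside the support amounts to adding a term. The rule serves for
  polynomials, term by term, and for monomials, variable by variable.\<close>

lemma poly_mapping_add_induct [case_names zero add]:
  fixes f :: "'k \<Rightarrow>\<^sub>0 'b::comm_monoid_add"
  assumes "P 0" and "\<And>k b f. P f \<Longrightarrow> P (Poly_Mapping.single k b + f)"
  shows "P f"
proof (induction f rule: update_induct)
  case const
  show ?case by (rule assms(1))
next
  case (update f k b)
  have "Poly_Mapping.update k b f = Poly_Mapping.single k b + f"
    using update(1) by (intro poly_mapping_eqI)
      (auto simp: lookup_update lookup_add lookup_single in_keys_iff)
  then show ?case using assms(2)[OF update(3)] by simp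
qed

section \<open>Evaluation of polynomials and the points of X(R)\<close>

definition monom_val :: "(nat \<Rightarrow> real) \<Rightarrow> (nat \<Rightarrow>\<^sub>0 nat) \<Rightarrow> real" where
  "monom_val x m = (\<Prod>i\<in>Poly_Mapping.keys m. x i ^ Poly_Mapping.lookup m i)"

text \<open>The point with coordinates \<open>x\<close> over \<open>v\<close>. It is defined for any
  function \<open>v\<close>, hence on all parameters of \<open>coord_alg\<close>.\<close>

definition poly_val :: "('a::zero \<Rightarrow> real) \<Rightarrow> (nat \<Rightarrow> real) \<Rightarrow> 'a inf_poly \<Rightarrow> real" where
  "poly_val v x f = (\<Sum>m\<in>Poly_Mapping.keys f. v (Poly_Mapping.lookup f m) * monom_val x m)"

lemma monom_val_superset:
  assumes "finite S" "Poly_Mapping.keys m \<subseteq> S"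
  shows "monom_val x m = (\<Prod>i\<in>S. x i ^ Poly_Mapping.lookup m i)"
  unfolding monom_val_def using assms by (intro prod.mono_neutral_left) (auto simp: in_keys_iff)

lemma monom_val_add: "monom_val x (m + m') = monom_val x m * monom_val x m'"
proof -
  let ?S = "Poly_Mapping.keys m \<union> Poly_Mapping.keys m'"
  have "monom_val x (m + m') = (\<Prod>i\<in>?S. x i ^ Poly_Mapping.lookup (m + m') i)"
    by (rule monom_val_superset) (auto simp: Poly_Mapping.keys_add)
  then show ?thesis
    by (simp add: monom_val_superset[of ?S m] monom_val_superset[of ?S m'] lookup_add power_add prod.distrib)
qed

lemma monom_val_0: "monom_val x 0 = 1"
  by (simp add: monom_val_def)

lemma poly_val_superset:
  assumes "v 0 = 0" "finite S" "Poly_Mapping.keys f \<subseteq> S"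
  shows "poly_val v x f = (\<Sum>m\<in>S. v (Poly_Mapping.lookup f m) * monom_val x m)"
  unfolding poly_val_def using assms by (intro sum.mono_neutral_left) (auto simp: in_keys_iff)

lemma poly_val_add:
  fixes v :: "'a::comm_monoid_add \<Rightarrow> real"
  assumes v: "v 0 = 0" "\<And>a b. v (a + b) = v a + v b"
  shows "poly_val v x (f + g) = poly_val v x f + poly_val v x g"
proof -
  let ?S = "Poly_Mapping.keys f \<union> Poly_Mapping.keys g"
  have "poly_val v x (f + g) = (\<Sum>m\<in>?S. v (Poly_Mapping.lookup (f + g) m) * monom_val x m)"
    by (rule poly_val_superset[where v=v, OF v(1)]) (auto simp: Poly_Mapping.keys_add)
  then show ?thesis
    by (simp add: poly_val_superset[where v=v and S="?S" and f=f, OF v(1)]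
        poly_val_superset[where v=v and S="?S" and f=g, OF v(1)]
        lookup_add v(2) sum.distrib distrib_right)
qed

lemma poly_val_single:
  assumes "v 0 = 0"
  shows "poly_val v x (Poly_Mapping.single m a) = v a * monom_val x m"
  using poly_val_superset[of v "{m}" "Poly_Mapping.single m a" x] assms by simp

lemma poly_val_mult:
  fixes v :: "'a::comm_semiring_0 \<Rightarrow> real"
  assumes v: "v 0 = 0" "\<And>a b. v (a + b) = v a + v b" "\<And>a b. v (a * b) = v a * v b"
  shows "poly_val v x (f * g) = poly_val v x f * poly_val v x g"
proof -
  have z: "poly_val v x 0 = 0" by (simp add: poly_val_def)
  have single: "poly_val v x (Poly_Mapping.single m a * g) = poly_val v x (Poly_Mapping.single m a) * poly_val v x g"
    for m a
    by (induction g rule: poly_mapping_add_induct)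
      (simp_all add: z distrib_left poly_val_add[where v=v, OF v(1,2)] mult_single poly_val_single[where v=v, OF v(1)] v(3) monom_val_add)
  show ?thesis
    by (induction f rule: poly_mapping_add_induct)
      (simp_all add: z distrib_right poly_val_add[where v=v, OF v(1,2)] single)
qed

lemma V_realD:
  fixes v :: "'a::{comm_ring, comm_monoid_mult, real_algebra} \<Rightarrow> real"
  assumes "v \<in> V_real"
  shows "v (a + b) = v a + v b" "v (a * b) = v a * v b" "v (c *\<^sub>R 1) = c" "v 0 = 0" "v 1 = 1"
proof -
  show *: "v (a + b) = v a + v b" "v (a * b) = v a * v b" "v (c *\<^sub>R 1) = c" for a b c
    using assms by (auto simp: V_real_def real_alg_homs_def)
  show "v 0 = 0" using *(3)[of 0] by simp
  show "v 1 = 1" using *(3)[of 1] by simp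
qed

lemma poly_val_X_real:
  assumes "v \<in> V_real"
  shows "poly_val v x \<in> X_real"
  using poly_val_add[of v] poly_val_mult[of v] V_realD[OF assms]
  by (auto simp: X_real_def real_alg_homs_def const_poly_def poly_val_single monom_val_0)

lemma proj_V_poly_val: "v 0 = 0 \<Longrightarrow> proj_V (poly_val v x) = v"
  by (simp add: proj_V_def const_poly_def poly_val_single monom_val_0)

lemma single_1_mult_const:
  "Poly_Mapping.single m (1::'a::{comm_semiring_0, monoid_mult}) * const_poly a = Poly_Mapping.single m a"
  by (simp add: const_poly_def mult_single)

text \<open>The values on constants and variables determine a homomorphism on powers of variables,
  then on monomials, then on terms and sums.\<close>

lemma X_real_eq_poly_val:
  fixes p :: "'a::{comm_ring, comm_monoid_mult, real_algebra} inf_poly \<Rightarrow> real"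
  assumes p: "p \<in> X_real"
  shows "proj_V p \<in> V_real" and "p = poly_val (proj_V p) (\<lambda>i. p (var_poly i))"
proof -
  have p_add: "p (f + g) = p f + p g" and p_mult: "p (f * g) = p f * p g"
    and p_const: "p (const_poly (c *\<^sub>R 1)) = c" for f g c
    using p by (auto simp: X_real_def real_alg_homs_def)
  have cadd: "const_poly (a + b) = const_poly a + const_poly b"
    and cmult: "const_poly (a * b) = const_poly a * const_poly b" for a b :: 'a
    by (simp_all add: const_poly_def single_add mult_single)
  show V: "proj_V p \<in> V_real"
    by (simp add: V_real_def real_alg_homs_def proj_V_def cadd cmult p_add p_mult p_const)
  note v = V_realD[OF V]
  define x where "x = (\<lambda>i. p (var_poly i))"
  have p0: "p 0 = 0" using p_add[of 0 0] by simp
  have p1: "p (Poly_Mapping.single 0 1) = 1" using p_const[of 1] by (simp add: const_poly_def)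
  have pow: "p (Poly_Mapping.single (Poly_Mapping.single i n) 1) = x i ^ n" for i n
  proof (induction n)
    case 0
    then show ?case using p1 by simp
  next
    case (Suc n)
    have "Poly_Mapping.single (Poly_Mapping.single i (Suc n)) (1::'a) =
        var_poly i * Poly_Mapping.single (Poly_Mapping.single i n) 1"
      by (simp add: var_poly_def mult_single flip: single_add)
    then show ?case using Suc by (simp add: p_mult x_def)
  qed
  have mono: "p (Poly_Mapping.single m 1) = monom_val x m" for m
  proof (induction m rule: poly_mapping_add_induct)
    case zero
    then show ?case using p1 by (simp add: monom_val_0)
  next
    case (add i n m)
    have "Poly_Mapping.single (Poly_Mapping.single i n + m) (1::'a) =
        Poly_Mapping.single (Poly_Mapping.single i n) 1 * Poly_Mapping.single m 1"
      by (simp add: mult_single)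
    moreover have "monom_val x (Poly_Mapping.single i n) = x i ^ n"
      using monom_val_superset[of "{i}" "Poly_Mapping.single i n" x] by simp
    ultimately show ?case by (simp add: p_mult pow add monom_val_add)
  qed
  have "p f = poly_val (proj_V p) x f" for f
  proof (induction f rule: poly_mapping_add_induct)
    case zero
    then show ?case by (simp add: p0 poly_val_def)
  next
    case (add m a f)
    have "p (Poly_Mapping.single m a) = proj_V p a * monom_val x m"
      using p_mult[of "Poly_Mapping.single m 1" "const_poly a"]
      by (simp add: single_1_mult_const mono proj_V_def)
    then show ?case
      by (simp add: p_add add poly_val_add[where v="proj_V p", OF v(4,1)] poly_val_single[where v="proj_V p", OF v(4)])
  qed
  then have "p = poly_val (proj_V p) x" by (rule ext)
  then show "p = poly_val (proj_V p) (\<lambda>i. p (var_poly i))" by (simp only: x_def)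
qed

text \<open>Precomposing a point with the action gives a point again, and points are determined by
  their values on constants and variables.\<close>

lemma poly_val_perm_act:
  fixes v :: "'a::{comm_ring, comm_monoid_mult, real_algebra} \<Rightarrow> real"
  assumes v: "v \<in> V_real" and \<sigma>: "\<sigma> \<in> Sym_infty"
  shows "poly_val v x (perm_act \<sigma> f) = poly_val v (x \<circ> \<sigma>) f"
proof -
  define p where "p f = poly_val v x (perm_act \<sigma> f)" for f
  have "poly_val v x \<in> X_real" by (rule poly_val_X_real[OF v])
  then have "p \<in> X_real"
    unfolding X_real_def real_alg_homs_def p_def
    by (simp add: perm_act_add[OF \<sigma>] perm_act_mult[OF \<sigma>] perm_act_const[OF \<sigma>])
  moreover have "proj_V p = v"
    using V_realD[OF v] by (simp add: proj_V_def p_def perm_act_const[OF \<sigma>])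
      (simp add: const_poly_def poly_val_single monom_val_0)
  moreover have "p (var_poly i) = (x \<circ> \<sigma>) i" for i
    using V_realD[OF v] by (simp add: p_def perm_act_var[OF \<sigma>])
      (simp add: var_poly_def poly_val_single monom_val_def)
  ultimately have "p = poly_val v (x \<circ> \<sigma>)" using X_real_eq_poly_val(2)[of p] by (simp only: o_def)
  then have "p f = poly_val v (x \<circ> \<sigma>) f" by (rule fun_cong)
  then show ?thesis by (simp only: p_def)
qed

lemma poly_val_coord_alg: "(\<lambda>p. poly_val (fst p) (snd p \<circ> \<sigma>) f) \<in> coord_alg"
  unfolding poly_val_def monom_val_def comp_def
  by (intro coord.sum coord.mult coord.prod coord.power coord_alg.coeff coord_alg.var)

lemma poly_val_cong:
  assumes "\<And>m i. m \<in> Poly_Mapping.keys f \<Longrightarrow> i \<in> Poly_Mapping.keys m \<Longrightarrow> x i = y i"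
  shows "poly_val v x f = poly_val v y f"
  unfolding poly_val_def monom_val_def using assms by (intro sum.cong prod.cong arg_cong2[of _ _ _ _ "(*)"]) auto

section \<open>Semialgebraic subsets of V(R)\<close>

lemma semialgebraic_V_full: "semialgebraic_V (V_real :: ('a::{comm_ring, comm_monoid_mult, real_algebra} \<Rightarrow> real) set)"
proof -
  have "v (0::'a) \<ge> 0" if "v \<in> V_real" for v using V_realD(4)[OF that] by simp
  then have "{v \<in> V_real. v (0::'a) \<ge> 0} = V_real" by blast
  then show ?thesis using semialgebraic_V.basic[of "0::'a"] by simp
qed

lemma semialgebraic_V_empty: "semialgebraic_V {}"
  using semialgebraic_V.compl[OF semialgebraic_V_full] by simp

lemma semialgebraic_V_UN:
  "finite I \<Longrightarrow> (\<And>i. i \<in> I \<Longrightarrow> semialgebraic_V (S i)) \<Longrightarrow> semialgebraic_V (\<Union>i\<in>I. S i)"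
  by (induction I rule: finite_induct) (auto intro: semialgebraic_V_empty semialgebraic_V.union)

lemma semialgebraic_V_INT:
  "finite I \<Longrightarrow> (\<And>i. i \<in> I \<Longrightarrow> semialgebraic_V (S i)) \<Longrightarrow> semialgebraic_V (V_real \<inter> (\<Inter>i\<in>I. S i))"
proof (induction I rule: finite_induct)
  case empty
  then show ?case by (simp add: semialgebraic_V_full)
next
  case (insert i I)
  have "V_real \<inter> (\<Inter>j\<in>insert i I. S j) = S i \<inter> (V_real \<inter> (\<Inter>j\<in>I. S j))" by auto
  then show ?case using insert by (simp add: semialgebraic_V.inter)
qed

lemma semialgebraic_V_sgn: "semialgebraic_V {v \<in> V_real. sgn (v a) = s}"
proof -
  have neg: "v a \<le> 0 \<longleftrightarrow> v (- a) \<ge> 0" if "v \<in> V_real" for v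
    using V_realD(1)[OF that, of a "- a"] V_realD(4)[OF that] by auto
  have le: "semialgebraic_V {v \<in> V_real. v a \<le> 0}"
  proof -
    have "{v \<in> V_real. v a \<le> 0} = {v \<in> V_real. v (- a) \<ge> 0}"
      by (intro Collect_cong conj_cong refl) (rule neg)
    then show ?thesis using semialgebraic_V.basic by simp
  qed
  consider "s = 1" | "s = -1" | "s = 0" | "s \<notin> {1, -1, 0}" by blast
  then show ?thesis
  proof cases
    case 1
    have "{v \<in> V_real. sgn (v a) = s} = V_real - {v \<in> V_real. v a \<le> 0}"
      using 1 by (auto simp: sgn_1_pos)
    then show ?thesis using semialgebraic_V.compl[OF le] by simp
  next
    case 2
    have "{v \<in> V_real. sgn (v a) = s} = V_real - {v \<in> V_real. v a \<ge> 0}"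
      using 2 by (auto simp: sgn_1_neg)
    then show ?thesis using semialgebraic_V.compl[OF semialgebraic_V.basic] by simp
  next
    case 3
    have "{v \<in> V_real. sgn (v a) = s} = {v \<in> V_real. v a \<le> 0} \<inter> {v \<in> V_real. v a \<ge> 0}"
      using 3 by (auto simp: sgn_0_0)
    then show ?thesis using semialgebraic_V.inter[OF le semialgebraic_V.basic] by simp
  next
    case 4
    have "sgn r \<in> {1, -1, 0}" for r :: real by (cases r "0::real" rule: linorder_cases) auto
    then have "{v \<in> V_real. sgn (v a) = s} = {}" using 4 by blast
    then show ?thesis using semialgebraic_V_empty by (simp only:)
  qed
qed

text \<open>Finitely many sign patterns on \<open>L\<close> occur on \<open>S\<close>, and
  \<open>S\<close> is the union of the semialgebraic sets they define.\<close>

lemma semialgebraic_V_of_sgn_determined: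
  fixes S :: "('a::{comm_ring, comm_monoid_mult, real_algebra} \<Rightarrow> real) set"
  assumes L: "finite L" and S: "S \<subseteq> V_real"
    and det: "\<And>v w. v \<in> S \<Longrightarrow> w \<in> V_real \<Longrightarrow> \<forall>a\<in>L. sgn (v a) = sgn (w a) \<Longrightarrow> w \<in> S"
  shows "semialgebraic_V S"
proof -
  define \<Sigma> where "\<Sigma> = (\<lambda>v. restrict (\<lambda>a. sgn (v a)) L) ` S"
  have "sgn r \<in> {1, -1, 0}" for r :: real by (cases r "0::real" rule: linorder_cases) auto
  then have "\<Sigma> \<subseteq> (\<Pi>\<^sub>E a\<in>L. {1, -1, 0})"
    unfolding \<Sigma>_def by (intro image_subsetI) (simp only: restrict_PiE_iff, blast)
  then have "finite \<Sigma>" using L by (auto intro: finite_subset finite_PiE)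
  moreover have "S = (\<Union>s\<in>\<Sigma>. V_real \<inter> (\<Inter>a\<in>L. {v \<in> V_real. sgn (v a) = s a}))"
  proof (intro equalityI subsetI)
    fix v assume "v \<in> S"
    then show "v \<in> (\<Union>s\<in>\<Sigma>. V_real \<inter> (\<Inter>a\<in>L. {v \<in> V_real. sgn (v a) = s a}))"
      using S by (force simp: \<Sigma>_def)
  next
    fix w assume "w \<in> (\<Union>s\<in>\<Sigma>. V_real \<inter> (\<Inter>a\<in>L. {v \<in> V_real. sgn (v a) = s a}))"
    then obtain v where "v \<in> S" "w \<in> V_real" "\<forall>a\<in>L. sgn (w a) = restrict (\<lambda>a. sgn (v a)) L a"
      by (auto simp: \<Sigma>_def)
    then show "w \<in> S" using det[of v w] by simp
  qed
  moreover have "semialgebraic_V (\<Union>s\<in>\<Sigma>. V_real \<inter> (\<Inter>a\<in>L. {v \<in> V_real. sgn (v a) = s a}))"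
    by (intro semialgebraic_V_UN \<open>finite \<Sigma>\<close> semialgebraic_V_INT L semialgebraic_V_sgn)
  ultimately show ?thesis by simp
qed

text \<open>At the zero sequence only a real polynomial expression in values of \<open>v\<close>
  remains, which a homomorphism contracts to a single value.\<close>

lemma coord_alg_at_zero:
  fixes f :: "('a::{comm_ring, comm_monoid_mult, real_algebra} \<Rightarrow> real) \<times> (nat \<Rightarrow> real) \<Rightarrow> real"
  assumes "f \<in> coord_alg"
  shows "\<exists>a. \<forall>v\<in>V_real. f (v, \<lambda>_. 0) = v a"
  using assms
proof induction
  case (const c)
  show ?case by (intro exI ballI) (rule V_realD(3)[symmetric])
next
  case (coeff a)
  show ?case by auto
next
  case (var i)
  show ?case unfolding snd_conv by (intro exI ballI) (rule V_realD(4)[symmetric])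
next
  case (add f g)
  then show ?case using V_realD(1) by (metis (no_types, lifting))
next
  case (mult f g)
  then show ?case using V_realD(2) by (metis (no_types, lifting))
qed

text \<open>\<open>\<phi>\<close> ignores the sequence, so it may be tested at the zero sequence,
  where the deciding functions are values of ring elements.\<close>

lemma semialgebraic_V_definable:
  fixes \<phi> :: "('a::{comm_ring, comm_monoid_mult, real_algebra} \<Rightarrow> real) \<Rightarrow> bool"
  assumes "coord.definable (\<lambda>p. \<phi> (fst p))"
  shows "semialgebraic_V {v \<in> V_real. \<phi> v}"
proof -
  obtain L where L: "finite L" "L \<subseteq> coord_alg"
    and det: "\<And>p q. coord.sgn_equal L p q \<Longrightarrow> \<phi> (fst p) = \<phi> (fst q)"
    using assms unfolding coord.definable_def by blast
  have "\<forall>f\<in>L. \<exists>a. \<forall>v\<in>V_real. f (v, \<lambda>_. 0) = v a"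
    using coord_alg_at_zero L(2) by blast
  then obtain a where a: "\<forall>f\<in>L. \<forall>v\<in>V_real. f (v, \<lambda>_. 0) = v (a f)" by metis
  show ?thesis
  proof (rule semialgebraic_V_of_sgn_determined[of "a ` L"])
    fix v w assume v: "v \<in> {v \<in> V_real. \<phi> v}" and w: "w \<in> V_real"
      and eq: "\<forall>b\<in>a ` L. sgn (v b) = sgn (w b)"
    have "sgn (f (v, \<lambda>_. 0)) = sgn (f (w, \<lambda>_. 0))" if "f \<in> L" for f
    proof -
      have "f (v, \<lambda>_. 0) = v (a f)" "f (w, \<lambda>_. 0) = w (a f)" using a that v w by blast+
      then show ?thesis using eq that by simp
    qed
    then have "\<phi> v = \<phi> w"
      using det[of "(v, \<lambda>_. 0)" "(w, \<lambda>_. 0)"] by (simp add: coord.sgn_equal_def)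
    then show "w \<in> {v \<in> V_real. \<phi> v}" using v w by simp
  qed (use L in auto)
qed

section \<open>Orbits under the infinite symmetric group\<close>

text \<open>In a large \<open>{..<k}\<close> the complements of the domain and of the image of
  \<open>e\<close> have equal size; a bijection between them completes \<open>e\<close>.\<close>

lemma Sym_infty_extend:
  assumes e: "inj_on e {..<m::nat}"
  shows "\<exists>\<sigma>\<in>Sym_infty. \<forall>i<m. \<sigma> i = e i"
proof -
  obtain k where "\<forall>i\<in>{..<m} \<union> e ` {..<m}. i < k"
    using finite_nat_set_iff_bounded[of "{..<m} \<union> e ` {..<m}"] by auto
  then have sub: "{..<m} \<subseteq> {..<k}" "e ` {..<m} \<subseteq> {..<k}" by auto
  have "card ({..<k} - {..<m}) = card ({..<k} - e ` {..<m})"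
    using sub card_image[OF e] by (simp add: card_Diff_subset)
  then obtain g where g: "bij_betw g ({..<k} - {..<m}) ({..<k} - e ` {..<m})"
    using finite_same_card_bij[of "{..<k} - {..<m}" "{..<k} - e ` {..<m}"] by auto
  define \<sigma> where "\<sigma> i = (if i < m then e i else if i < k then g i else i)" for i
  have "bij_betw \<sigma> {..<m} (e ` {..<m})"
    using e by (auto simp: bij_betw_def \<sigma>_def inj_on_def)
  moreover have "bij_betw \<sigma> ({..<k} - {..<m}) ({..<k} - e ` {..<m})"
    using g by (subst bij_betw_cong[of _ _ g]) (auto simp: \<sigma>_def)
  ultimately have "bij_betw \<sigma> ({..<m} \<union> ({..<k} - {..<m})) (e ` {..<m} \<union> ({..<k} - e ` {..<m}))"
    by (rule bij_betw_combine) auto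
  moreover have "{..<m} \<union> ({..<k} - {..<m}) = {..<k}" "e ` {..<m} \<union> ({..<k} - e ` {..<m}) = {..<k}"
    using sub by auto
  ultimately have "bij_betw \<sigma> {..<k} {..<k}" by (simp only:)
  then have "\<sigma> permutes {..<k}"
    using sub(1) by (intro bij_imp_permutes) (auto simp: \<sigma>_def)
  then have "\<sigma> \<in> Sym_infty" by (auto simp: Sym_infty_def)
  then show ?thesis by (intro bexI[of _ \<sigma>]) (simp_all add: \<sigma>_def)
qed

text \<open>Imposing the condition in every order of the entries allows index tuples to be
  restricted to increasing ones, which stay increasing along subsequences.\<close>

definition sym_tuple :: "nat \<Rightarrow> ((nat \<Rightarrow> real) \<Rightarrow> bool) \<Rightarrow> real list \<Rightarrow> bool" where
  "sym_tuple m \<Phi> ts \<longleftrightarrow> (\<forall>\<pi>\<in>{\<pi>. \<pi> permutes {..<m}}. \<Phi> (\<lambda>i. ts ! \<pi> i))"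

text \<open>A permutation matters only through its restriction to \<open>{..<m}\<close>. This is an
  arbitrary injection, that is, an increasing list composed with a permutation of its
  positions.\<close>

lemma Sym_infty_iff_sym_tuple:
  assumes cong: "\<And>x y. (\<And>i. i < m \<Longrightarrow> x i = y i) \<Longrightarrow> \<Phi> x = \<Phi> y"
  shows "(\<forall>\<sigma>\<in>Sym_infty. \<Phi> (x \<circ> \<sigma>)) \<longleftrightarrow>
    (\<forall>js. sorted_wrt (<) js \<longrightarrow> length js = m \<longrightarrow> sym_tuple m \<Phi> (map x js))"
    (is "?L \<longleftrightarrow> ?R")
proof
  assume L: ?L
  show ?R unfolding sym_tuple_def
  proof (intro allI impI ballI)
    fix js :: "nat list" and \<pi> assume js: "sorted_wrt (<) js" "length js = m" and "\<pi> \<in> {\<pi>. \<pi> permutes {..<m}}"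
    then have \<pi>: "\<pi> permutes {..<m}" by simp
    have "distinct js" using js(1) by (simp add: strict_sorted_iff)
    moreover have "\<pi> i < length js" if "i < m" for i
      using permutes_in_image[OF \<pi>, of i] js(2) that by simp
    ultimately have "inj_on (\<lambda>i. js ! \<pi> i) {..<m}"
      using permutes_inj[OF \<pi>] by (intro inj_onI) (simp add: nth_eq_iff_index_eq inj_eq)
    then obtain \<sigma> where \<sigma>: "\<sigma> \<in> Sym_infty" "\<forall>i<m. \<sigma> i = js ! \<pi> i"
      using Sym_infty_extend by blast
    have "\<Phi> (\<lambda>i. map x js ! \<pi> i) = \<Phi> (x \<circ> \<sigma>)"
    proof (rule cong)
      fix i assume "i < m"
      moreover from this have "\<pi> i < m" using permutes_in_image[OF \<pi>, of i] by simp
      ultimately show "map x js ! \<pi> i = (x \<circ> \<sigma>) i" using \<sigma>(2) js(2) by simp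
    qed
    then show "\<Phi> (\<lambda>i. map x js ! \<pi> i)" using L \<sigma>(1) by blast
  qed
next
  assume R: ?R
  show ?L
  proof
    fix \<sigma> :: "nat \<Rightarrow> nat" assume "\<sigma> \<in> Sym_infty"
    then have "inj_on \<sigma> {0..<m}" using bij_Sym_infty bij_is_inj inj_on_subset by blast
    then have d: "distinct (map \<sigma> [0..<m])" by (simp add: distinct_map)
    define js where "js = sort (map \<sigma> [0..<m])"
    have js: "sorted_wrt (<) js" "length js = m"
      using d by (simp_all add: js_def strict_sorted_iff)
    have "mset (map \<sigma> [0..<m]) = mset js" by (simp add: js_def)
    then obtain \<pi> where \<pi>: "\<pi> permutes {..<length js}" "permute_list \<pi> js = map \<sigma> [0..<m]"
      by (rule mset_eq_permutation)
    have "\<Phi> (\<lambda>i. map x js ! \<pi> i) = \<Phi> (x \<circ> \<sigma>)"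
    proof (rule cong)
      fix i assume i: "i < m"
      then have "\<pi> i < m" using permutes_in_image[OF \<pi>(1), of i] js(2) by simp
      moreover have "js ! \<pi> i = \<sigma> i"
        using permute_list_nth[OF \<pi>(1), of i] \<pi>(2) i js(2) by simp
      ultimately show "map x js ! \<pi> i = (x \<circ> \<sigma>) i" using js(2) by simp
    qed
    then show "\<Phi> (x \<circ> \<sigma>)" using R js \<pi>(1) by (auto simp: sym_tuple_def)
  qed
qed

text \<open>The existence of an infinite sequence becomes a choice among finitely many limit types,
  one real limit point and \<open>m\<close> quantifiers along the filter, each of which preserves
  definability.\<close>

lemma definable_Sym_infty_orbit:
  fixes \<Phi> :: "('a \<Rightarrow> real) \<Rightarrow> (nat \<Rightarrow> real) \<Rightarrow> bool"
  assumes cong: "\<And>v x y. (\<And>i. i < m \<Longrightarrow> x i = y i) \<Longrightarrow> \<Phi> v x = \<Phi> v y"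
    and def: "\<And>\<sigma>. coord.definable (\<lambda>p. \<Phi> (fst p) (snd p \<circ> \<sigma>))"
  shows "coord.definable (\<lambda>p. \<exists>x. \<forall>\<sigma>\<in>Sym_infty. \<Phi> (fst p) (x \<circ> \<sigma>))"
proof -
  define G where "G v = sym_tuple m (\<Phi> v)" for v
  have G_definable: "coord.definable (\<lambda>p. G (fst p) (map (snd p) [0..<m]))"
  proof -
    have "\<Phi> v (\<lambda>i. map x [0..<m] ! \<pi> i) = \<Phi> v (x \<circ> \<pi>)" if "\<pi> permutes {..<m}" for v x \<pi>
      using permutes_in_image[OF that] by (intro cong) simp
    then have "G v (map x [0..<m]) \<longleftrightarrow> (\<forall>\<pi>\<in>{\<pi>. \<pi> permutes {..<m}}. \<Phi> v (x \<circ> \<pi>))" for v x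
      by (simp add: G_def sym_tuple_def)
    then show ?thesis
      by (simp only:) (intro coord.definable_ball finite_permutations def finite_lessThan)
  qed
  have iter_def: "coord.definable (\<lambda>p. iter_eventually (K (snd p m)) (G (fst p)) r (map (snd p) [0..<m - r]))"
    if "K \<in> limit_types" "r \<le> m" for K r
    using definable_iter_eventually[OF that(1) order_refl G_definable that(2)] .
  have orbit: "(\<forall>\<sigma>\<in>Sym_infty. \<Phi> v (x \<circ> \<sigma>)) \<longleftrightarrow>
      (\<forall>js. sorted_wrt (<) js \<longrightarrow> length js = m \<longrightarrow> G v (map x js))" for v x
    unfolding G_def by (rule Sym_infty_iff_sym_tuple) (rule cong)
  \<comment> \<open>The coordinate of index \<open>m\<close>, on which \<open>\<Phi>\<close> does not depend, holds the limit point.\<close>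
  have "(\<exists>x. \<forall>\<sigma>\<in>Sym_infty. \<Phi> v (x \<circ> \<sigma>)) \<longleftrightarrow>
      (\<exists>K\<in>limit_types. \<exists>c. iter_eventually (K c) (G v) m [])" (is "?L \<longleftrightarrow> ?R") for v
  proof
    assume ?L
    then obtain x :: "nat \<Rightarrow> real" where x: "\<And>js. sorted_wrt (<) js \<Longrightarrow> length js = m \<Longrightarrow> G v (map x js)"
      unfolding orbit by blast
    obtain r K c where r: "strict_mono r" and K: "K \<in> limit_types"
      and lim: "filterlim (x \<circ> r) (K c) sequentially"
      by (rule limit_type_subseq)
    have "iter_eventually (K c) (G v) m (map (x \<circ> r) [])"
    proof (rule iter_eventually_of_seq[OF lim])
      show "G v (map (x \<circ> r) js)" if "sorted_wrt (<) js" "length js = m" for js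
        using x[of "map r js"] that r by (simp add: sorted_wrt_map strict_mono_less)
    next
      fix k and ts :: "real list" assume k: "Suc k + length ts = m"
      \<comment> \<open>\<open>p\<close> encodes \<open>ts\<close> in the coordinates below
        \<open>length ts\<close> and the limit point in all others, in particular at
        \<open>m\<close>.\<close>
      define p where "p = (v, \<lambda>i. if i < length ts then ts ! i else c)"
      have len: "m - k = Suc (length ts)" "length ts \<noteq> m" "k \<le> m" using k by auto
      have "map (snd (upd (length ts) t p)) [0..<m - k] = ts @ [t]" for t
        unfolding len(1)
        by (intro nth_equalityI) (auto simp: p_def nth_append less_Suc_eq simp del: upt_Suc)
      moreover have "snd (upd (length ts) t p) m = c" "fst (upd (length ts) t p) = v" for t
        using k by (simp_all add: p_def)
      ultimately show "eventually (\<lambda>t. iter_eventually (K c) (G v) k (ts @ [t])) (K c) \<or>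
          eventually (\<lambda>t. \<not> iter_eventually (K c) (G v) k (ts @ [t])) (K c)"
        using definable_decided[OF iter_def[OF K len(3)] K, of "length ts" p c] by (simp only:)
    qed auto
    then show ?R using K by auto
  next
    assume ?R
    then obtain K c where K: "K \<in> limit_types" and iter: "iter_eventually (K c) (G v) m []" by blast
    show ?L
      unfolding orbit by (rule seq_of_iter_eventually[OF limit_type_neq_bot[OF K] iter])
  qed
  moreover have "coord.definable (\<lambda>p. \<exists>K\<in>limit_types. \<exists>c. iter_eventually (K c) (G (fst p)) m [])"
  proof (intro coord.definable_bex finite_limit_types)
    fix K assume "K \<in> limit_types"
    from definable_ex[OF iter_def[OF this order_refl], of m]
    show "coord.definable (\<lambda>p. \<exists>c. iter_eventually (K c) (G (fst p)) m [])" by simp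
  qed
  ultimately show ?thesis by (simp only:)
qed

text \<open>Points over \<open>v\<close> are evaluations at sequences, and the action on polynomials
  becomes a permutation of the sequence.\<close>

lemma proj_V_basic_equivariant:
  fixes fs gs :: "'a::{comm_ring, comm_monoid_mult, real_algebra} inf_poly list"
  assumes Y: "Y = (\<Inter>\<sigma>\<in>Sym_infty. {p \<in> X_real. (\<forall>f\<in>set fs. p (perm_act \<sigma> f) \<ge> 0) \<and>
                                            (\<forall>g\<in>set gs. p (perm_act \<sigma> g) > 0)})"
  shows "proj_V ` Y = {v \<in> V_real. \<exists>x. \<forall>\<sigma>\<in>Sym_infty.
    (\<forall>f\<in>set fs. poly_val v (x \<circ> \<sigma>) f \<ge> 0) \<and> (\<forall>g\<in>set gs. poly_val v (x \<circ> \<sigma>) g > 0)}"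
    (is "_ = ?S")
proof (intro equalityI subsetI)
  \<comment> \<open>The group is nonempty, so the intersection defining \<open>Y\<close> lies in
    \<open>X_real\<close>.\<close>
  have "id \<in> Sym_infty" by (auto simp: Sym_infty_def intro: permutes_id)
  then have Y_iff: "p \<in> Y \<longleftrightarrow> p \<in> X_real \<and> (\<forall>\<sigma>\<in>Sym_infty.
      (\<forall>f\<in>set fs. p (perm_act \<sigma> f) \<ge> 0) \<and> (\<forall>g\<in>set gs. p (perm_act \<sigma> g) > 0))" for p
    unfolding Y by blast
  show "v \<in> ?S" if "v \<in> proj_V ` Y" for v
  proof -
    obtain p where p: "p \<in> Y" "v = proj_V p" using \<open>v \<in> proj_V ` Y\<close> by blast
    define x where "x = (\<lambda>i. p (var_poly i))"
    have "p \<in> X_real" using p(1) by (simp add: Y_iff)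
    then have v: "v \<in> V_real" and px: "p = poly_val v x"
      using X_real_eq_poly_val[of p] p(2) by (simp, simp only: x_def)
    show ?thesis
      using p(1) v unfolding Y_iff px
      by (auto intro!: exI[of _ x] simp: poly_val_perm_act)
  qed
  show "v \<in> proj_V ` Y" if "v \<in> ?S" for v
  proof -
    obtain x where v: "v \<in> V_real" and x: "\<forall>\<sigma>\<in>Sym_infty.
      (\<forall>f\<in>set fs. poly_val v (x \<circ> \<sigma>) f \<ge> 0) \<and> (\<forall>g\<in>set gs. poly_val v (x \<circ> \<sigma>) g > 0)"
      using \<open>v \<in> ?S\<close> by blast
    have "poly_val v x \<in> Y"
      using x poly_val_X_real[OF v] by (simp add: Y_iff poly_val_perm_act[OF v])
    moreover have "proj_V (poly_val v x) = v"
      using V_realD(4)[OF v] by (rule proj_V_poly_val)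
    ultimately show ?thesis by (metis imageI)
  qed
qed

theorem theorem4p4:
  fixes Y :: "('a::{comm_ring, comm_monoid_mult, real_algebra} inf_poly \<Rightarrow> real) set"
  assumes "fin_gen_real_algebra TYPE('a)"
    and "reduced_ring TYPE('a)"
    and "basic_equivariant_semialgebraic Y"
  shows "semialgebraic_V (proj_V ` Y)"
proof -
  obtain fs gs :: "'a inf_poly list" where
    Y: "Y = (\<Inter>\<sigma>\<in>Sym_infty. {p \<in> X_real. (\<forall>f\<in>set fs. p (perm_act \<sigma> f) \<ge> 0) \<and>
                                        (\<forall>g\<in>set gs. p (perm_act \<sigma> g) > 0)})"
    using assms(3) unfolding basic_equivariant_semialgebraic_def by blast
  define \<Phi> where "\<Phi> v x \<longleftrightarrow> (\<forall>f\<in>set fs. poly_val v x f \<ge> 0) \<and> (\<forall>g\<in>set gs. poly_val v x g > 0)"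
    for v :: "'a \<Rightarrow> real" and x
  \<comment> \<open>Finitely many variables occur in the given polynomials; a bound \<open>m\<close>
    on their indices makes \<open>\<Phi>\<close> depend on the first \<open>m\<close> entries
    only.\<close>
  define vars where "vars = (\<Union>f\<in>set fs \<union> set gs. \<Union>n\<in>Poly_Mapping.keys f. Poly_Mapping.keys n)"
  have "finite vars" by (simp add: vars_def)
  then obtain m where m: "\<forall>i\<in>vars. i < m" using finite_nat_set_iff_bounded by blast
  have cong: "\<Phi> v x = \<Phi> v y" if xy: "\<And>i. i < m \<Longrightarrow> x i = y i" for v x y
  proof -
    have "poly_val v x f = poly_val v y f" if "f \<in> set fs \<union> set gs" for f
      using m xy that by (intro poly_val_cong) (auto simp: vars_def)
    then show ?thesis by (simp add: \<Phi>_def)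
  qed
  have def: "coord.definable (\<lambda>p. \<Phi> (fst p) (snd p \<circ> \<sigma>))" for \<sigma>
    unfolding \<Phi>_def
    by (intro coord.definable_conj coord.definable_ball finite_set
        coord.definable_ge coord.definable_gt poly_val_coord_alg)
  have "semialgebraic_V {v \<in> V_real. \<exists>x. \<forall>\<sigma>\<in>Sym_infty. \<Phi> v (x \<circ> \<sigma>)}"
    by (rule semialgebraic_V_definable[OF definable_Sym_infty_orbit[OF cong def]])
  then show ?thesis by (simp add: proj_V_basic_equivariant[OF Y] \<Phi>_def)
qed

end
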